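(* Let $T$ be a triangle in $\mathbb{R}^2$ and $d\geq 1$ an integer. For any $f\in W^{d+1,p}(T)$ with $1\leq p\leq \infty$, the quadrature rule with domain points $\xi_{ijk}$ and weights $w_{ijk}$ (defined in the context) satisfies $$\left|\int_{T}f(x,y)\,dx\,dy - \sum_{i+j+k=d}w_{ijk}f(\xi_{ijk})\right|\leq K_1|A_T|^{1/q}\,|T|^{d+1}\,|f|_{d+1, p, T},$$ where $1/p+1/q =1$ and $K_1>0$ is the interpolation constant described in the context.
   Context: $T$ is a nondegenerate triangle with vertices $(x_1,y_1),(x_2,y_2),(x_3,y_3)$; $A_T$ is its area, $|T|$ the length of its longest edge, $\rho_T$ the radius of its largest inscribed disk, and $\kappa_T=|T|/\rho_T$ its shape parameter. $\mathbb{P}_d$ is the space of bivariate real polynomials of total degree at most $d$. Indices are triples of nonnegative integers. Barycentric coordinates $(b_1,b_2,b_3)$ of $(x,y)$ solve $x=\sum_i b_ix_i$, $y=\sum_i b_iy_i$, $1=\sum_i b_i$. The Bernstein--Bézier polynomials are $B^T_{ijk}(x,y)=\frac{d!}{i!\,j!\,k!}b_1^ib_2^jb_3^k$, $i+j+k=d$. The domain points are $\xi_{ijk}=\frac{i(x_1,y_1)+j(x_2,y_2)+k(x_3,y_3)}{d}$, $i+j+k=d$. $\mathbf{B}$ is the (invertible) square matrix of size $\binom{d+2}{2}$ with entries $B^T_{lmn}(\xi_{ijk})$ (row index $ijk$, column index $lmn$, lexicographical order), and the weights are $w_{ijk}=\frac{A_T}{\binom{d+2}{2}}\sigma_{ijk}(\mathbf{B}^{-1})$,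 where $\sigma_{ijk}(\mathbf{B}^{-1})$ is the $ijk$-th column sum of $\mathbf{B}^{-1}$. $\|\cdot\|_{p,T}$ is the $L^p(T)$ norm. The Sobolev semi-norm is $|f|_{k,p,T}=\big[\sum_{\nu+\mu=k}\|D_x^\nu D_y^\mu f\|_{p,T}^p\big]^{1/p}$ for $1\le p<\infty$ and $|f|_{k,\infty,T}=\max_{\nu+\mu=k}\|D_x^\nu D_y^\mu f\|_{\infty,T}$; $W^{d+1,p}(T)$ is the usual Sobolev space, and point values refer to the continuous representative. Interpolation constant (known result): for $f\in W^{d+1,p}(T)$, the polynomial $P_f\in\mathbb{P}_d$ interpolating $f$ at the domain points satisfies $\|f-P_f\|_{p,T}\le K_1|T|^{d+1}|f|_{d+1,p,T}$, where $K_1>0$ depends only on $d$ if $p=\infty$, and on $d$ and $\kappa_T$ if $1\le p<\infty$. *)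

theory Defs
  imports
    "HOL-Analysis.Analysis"
    "HOL-Probability.Essential_Supremum"
    "Jordan_Normal_Form.Gauss_Jordan_Elimination"
begin

section \<open>Triangles\<close>

text \<open>A triangle is given by its ordered vertices; the order fixes the barycentric coordinates.
  The norm on \<open>real \<times> real\<close> is the Euclidean one, so \<open>dist\<close> and \<open>cball\<close> have their usual meaning.\<close>

type_synonym point = "real \<times> real"
type_synonym triangle = "point \<times> point \<times> point"
type_synonym index = "nat \<times> nat \<times> nat"

fun nondegenerate :: "triangle \<Rightarrow> bool" where
  "nondegenerate (v1, v2, v3) \<longleftrightarrow> \<not> collinear {v1, v2, v3}"

fun region :: "triangle \<Rightarrow> point set" where
  "region (v1, v2, v3) = convex hull {v1, v2, v3}"

definition area :: "triangle \<Rightarrow> real" where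
  "area T = measure lebesgue (region T)"

fun longest_edge :: "triangle \<Rightarrow> real" where
  "longest_edge (v1, v2, v3) = Max {dist v1 v2, dist v2 v3, dist v3 v1}"

definition inradius :: "triangle \<Rightarrow> real" where
  "inradius T = Sup {r. r > 0 \<and> (\<exists>c. cball c r \<subseteq> region T)}"

definition shape_parameter :: "triangle \<Rightarrow> real" where
  "shape_parameter T = longest_edge T / inradius T"

section \<open>Bernstein--Bezier polynomials, domain points and weights\<close>

fun barycentric :: "triangle \<Rightarrow> point \<Rightarrow> real \<times> real \<times> real" where
  "barycentric ((x1, y1), (x2, y2), (x3, y3)) (x, y) =
     (THE b. case b of (b1, b2, b3) \<Rightarrow>
        x = b1 * x1 + b2 * x2 + b3 * x3 \<and>
        y = b1 * y1 + b2 * y2 + b3 * y3 \<and>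
        1 = b1 + b2 + b3)"

definition multi_indices :: "nat \<Rightarrow> index set" where
  "multi_indices d = {(i, j, k). i + j + k = d}"

fun bernstein_bezier :: "triangle \<Rightarrow> nat \<Rightarrow> index \<Rightarrow> point \<Rightarrow> real" where
  "bernstein_bezier T d (i, j, k) z =
     (case barycentric T z of (b1, b2, b3) \<Rightarrow>
        fact d / (fact i * fact j * fact k) * b1 ^ i * b2 ^ j * b3 ^ k)"

fun domain_point :: "triangle \<Rightarrow> nat \<Rightarrow> index \<Rightarrow> point" where
  "domain_point (v1, v2, v3) d (i, j, k) =
     (1 / real d) *\<^sub>R (real i *\<^sub>R v1 + real j *\<^sub>R v2 + real k *\<^sub>R v3)"

text \<open>Lexicographical enumeration of \<open>multi_indices d\<close>, used for both rows and columns.\<close>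

definition index_list :: "nat \<Rightarrow> index list" where
  "index_list d = [(i, j, d - i - j). i \<leftarrow> [0..<Suc d], j \<leftarrow> [0..<Suc (d - i)]]"

definition index_pos :: "nat \<Rightarrow> index \<Rightarrow> nat" where
  "index_pos d t = (THE c. c < length (index_list d) \<and> index_list d ! c = t)"

definition bb_matrix :: "triangle \<Rightarrow> nat \<Rightarrow> real mat" where
  "bb_matrix T d =
     Matrix.mat ((d + 2) choose 2) ((d + 2) choose 2)
       (\<lambda>(r, c). bernstein_bezier T d (index_list d ! c) (domain_point T d (index_list d ! r)))"

definition column_sum :: "real mat \<Rightarrow> nat \<Rightarrow> real" where
  "column_sum M c = (\<Sum>r<dim_row M. M $$ (r, c))"

definition quadrature_weight :: "triangle \<Rightarrow> nat \<Rightarrow> index \<Rightarrow> real" where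
  "quadrature_weight T d t =
     area T / real ((d + 2) choose 2) *
     column_sum (the (mat_inverse (bb_matrix T d))) (index_pos d t)"

lemma set_index_list: "set (index_list d) = multi_indices d"
proof -
  have "(i, j, k) \<in> set (index_list d) \<longleftrightarrow> i + j + k = d" for i j k
    unfolding index_list_def by (auto simp: image_iff simp del: upt_Suc)
  then show ?thesis
    unfolding multi_indices_def by auto
qed

lemma distinct_index_list: "distinct (index_list d)"
proof -
  have "distinct (concat (map (\<lambda>i. map (\<lambda>j. (i, j, d - i - j)) [0..<Suc (d - i)]) xs))"
    if "distinct xs" for xs
    using that by (induction xs) (auto simp: distinct_map inj_on_def simp del: upt_Suc)
  from this[of "[0..<Suc d]"] show ?thesis
    unfolding index_list_def by (simp del: upt_Suc)
qed

lemma length_index_list: "length (index_list d) = (d + 2) choose 2"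
proof -
  have "length (index_list d) = (\<Sum>i<Suc d. Suc (d - i))"
    unfolding index_list_def
    by (simp add: length_concat o_def interv_sum_list_conv_sum_set_nat atLeast0LessThan del: upt_Suc)
  also have "\<dots> = (\<Sum>i<Suc d. Suc i)"
    using sum.nat_diff_reindex[of Suc "Suc d"] by (simp del: sum.lessThan_Suc)
  also have "\<dots> = (d + 2) choose 2"
    by (induction d) (simp_all add: numeral_2_eq_2)
  finally show ?thesis .
qed

definition poly_space :: "nat \<Rightarrow> (point \<Rightarrow> real) set" where
  "poly_space d =
     {P. \<exists>c :: nat \<Rightarrow> nat \<Rightarrow> real. \<forall>x y.
        P (x, y) = (\<Sum>(i, j) \<in> {(i, j). i + j \<le> d}. c i j * x ^ i * y ^ j)}"

section \<open>Lebesgue and Sobolev spaces\<close>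

text \<open>The exponent is an \<open>ennreal\<close>, with \<open>\<infinity>\<close> standing for infinity.
  \<open>Lp_norm\<close> is only meaningful for members of \<open>Lp_space\<close>.\<close>

definition Lp_space :: "ennreal \<Rightarrow> point set \<Rightarrow> (point \<Rightarrow> real) set" where
  "Lp_space p S =
     {f. f \<in> borel_measurable (lebesgue_on S) \<and>
         (if p = \<infinity> then esssup (lebesgue_on S) (\<lambda>z. ennreal \<bar>f z\<bar>) < \<infinity>
          else integrable (lebesgue_on S) (\<lambda>z. \<bar>f z\<bar> powr enn2real p))}"

definition Lp_norm :: "ennreal \<Rightarrow> point set \<Rightarrow> (point \<Rightarrow> real) \<Rightarrow> real" where
  "Lp_norm p S f =
     (if p = \<infinity> then enn2real (esssup (lebesgue_on S) (\<lambda>z. ennreal \<bar>f z\<bar>))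
      else (\<integral>z. \<bar>f z\<bar> powr enn2real p \<partial>lebesgue_on S) powr (1 / enn2real p))"

definition partial_x :: "(point \<Rightarrow> real) \<Rightarrow> point \<Rightarrow> real" where
  "partial_x g = (\<lambda>(x, y). deriv (\<lambda>s. g (s, y)) x)"

definition partial_y :: "(point \<Rightarrow> real) \<Rightarrow> point \<Rightarrow> real" where
  "partial_y g = (\<lambda>(x, y). deriv (\<lambda>t. g (x, t)) y)"

primrec C_k :: "nat \<Rightarrow> (point \<Rightarrow> real) \<Rightarrow> bool" where
  "C_k 0 g \<longleftrightarrow> continuous_on UNIV g"
| "C_k (Suc n) g \<longleftrightarrow>
     (\<forall>x y. (\<lambda>s. g (s, y)) differentiable (at x)) \<and>
     (\<forall>x y. (\<lambda>t. g (x, t)) differentiable (at y)) \<and>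
     C_k n (partial_x g) \<and> C_k n (partial_y g)"

definition test_function :: "point set \<Rightarrow> (point \<Rightarrow> real) \<Rightarrow> bool" where
  "test_function \<Omega> \<phi> \<longleftrightarrow>
     (\<forall>n. C_k n \<phi>) \<and> compact (closure {z. \<phi> z \<noteq> 0}) \<and> closure {z. \<phi> z \<noteq> 0} \<subseteq> \<Omega>"

definition locally_integrable :: "point set \<Rightarrow> (point \<Rightarrow> real) \<Rightarrow> bool" where
  "locally_integrable \<Omega> f \<longleftrightarrow> (\<forall>K. compact K \<and> K \<subseteq> \<Omega> \<longrightarrow> set_integrable lebesgue K f)"

text \<open>\<open>g\<close> is the distributional derivative of \<open>f\<close> of order \<open>\<nu>\<close> in x and \<open>\<mu>\<close> in y
  on the open set \<open>\<Omega>\<close>.\<close>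

definition is_weak_deriv ::
    "point set \<Rightarrow> nat \<Rightarrow> nat \<Rightarrow> (point \<Rightarrow> real) \<Rightarrow> (point \<Rightarrow> real) \<Rightarrow> bool" where
  "is_weak_deriv \<Omega> \<nu> \<mu> f g \<longleftrightarrow>
     locally_integrable \<Omega> f \<and> locally_integrable \<Omega> g \<and>
     (\<forall>\<phi>. test_function \<Omega> \<phi> \<longrightarrow>
        (LINT z:\<Omega>|lebesgue. f z * (partial_x ^^ \<nu>) ((partial_y ^^ \<mu>) \<phi>) z) =
        (- 1) ^ (\<nu> + \<mu>) * (LINT z:\<Omega>|lebesgue. g z * \<phi> z))"

text \<open>Weak derivatives are unique up to null sets, so the choice below does not affect \<open>Lp_norm\<close>.
  The boundary of a triangle is a null set: derivatives live on the interior, norms are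
  taken over the closed triangle.\<close>

definition weak_deriv :: "triangle \<Rightarrow> nat \<Rightarrow> nat \<Rightarrow> (point \<Rightarrow> real) \<Rightarrow> point \<Rightarrow> real" where
  "weak_deriv T \<nu> \<mu> f = (SOME g. is_weak_deriv (interior (region T)) \<nu> \<mu> f g)"

definition sobolev_space :: "nat \<Rightarrow> ennreal \<Rightarrow> triangle \<Rightarrow> (point \<Rightarrow> real) set" where
  "sobolev_space m p T =
     {f \<in> Lp_space p (region T).
        \<forall>\<nu> \<mu>. \<nu> + \<mu> \<le> m \<longrightarrow>
          (\<exists>g \<in> Lp_space p (region T). is_weak_deriv (interior (region T)) \<nu> \<mu> f g)}"

definition sobolev_seminorm :: "nat \<Rightarrow> ennreal \<Rightarrow> triangle \<Rightarrow> (point \<Rightarrow> real) \<Rightarrow> real" where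
  "sobolev_seminorm m p T f =
     (if p = \<infinity> then
        Max ((\<lambda>(\<nu>, \<mu>). Lp_norm p (region T) (weak_deriv T \<nu> \<mu> f)) ` {(\<nu>, \<mu>). \<nu> + \<mu> = m})
      else
        (\<Sum>(\<nu>, \<mu>) \<in> {(\<nu>, \<mu>). \<nu> + \<mu> = m}.
           Lp_norm p (region T) (weak_deriv T \<nu> \<mu> f) powr enn2real p) powr (1 / enn2real p))"

text \<open>Point values of a Sobolev function refer to its continuous representative, which is unique on
  the closed triangle. It exists for two or more weak derivatives in \<open>L\<^sup>p\<close>, \<open>p \<ge> 1\<close>, by the Sobolev
  embedding theorem.\<close>

definition continuous_rep :: "triangle \<Rightarrow> (point \<Rightarrow> real) \<Rightarrow> point \<Rightarrow> real" where
  "continuous_rep T f =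
     (SOME g. continuous_on (region T) g \<and> (AE z in lebesgue_on (region T). g z = f z))"

section \<open>The interpolation constant\<close>

definition interpolates :: "triangle \<Rightarrow> nat \<Rightarrow> (point \<Rightarrow> real) \<Rightarrow> (point \<Rightarrow> real) \<Rightarrow> bool" where
  "interpolates T d f P \<longleftrightarrow>
     P \<in> poly_space d \<and>
     (\<forall>t \<in> multi_indices d. P (domain_point T d t) = continuous_rep T f (domain_point T d t))"

text \<open>\<open>K\<close> may depend only on \<open>d\<close> if \<open>p = \<infinity>\<close>, and only on \<open>d\<close> and the shape parameter of
  \<open>T\<close> if \<open>p < \<infinity>\<close>. Hence the same \<open>K\<close> must serve all triangles and exponents
  that agree with \<open>T\<close> and \<open>p\<close> in these data.\<close>

definition interpolation_constant :: "nat \<Rightarrow> ennreal \<Rightarrow> triangle \<Rightarrow> real \<Rightarrow> bool" where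
  "interpolation_constant d p T K \<longleftrightarrow>
     K > 0 \<and>
     (\<forall>p' T' f P.
        nondegenerate T' \<and>
        (if p = \<infinity> then p' = \<infinity>
         else 1 \<le> p' \<and> p' < \<infinity> \<and> shape_parameter T' = shape_parameter T) \<and>
        f \<in> sobolev_space (d + 1) p' T' \<and> interpolates T' d f P \<longrightarrow>
        Lp_norm p' (region T') (\<lambda>z. f z - P z) \<le>
          K * longest_edge T' ^ (d + 1) * sobolev_seminorm (d + 1) p' T' f)"

end

theory Submission
  imports Defs "Jordan_Normal_Form.Determinant"
begin

text \<open>The quadrature rule integrates the interpolant exactly: if \<open>c = B\<^sup>-\<^sup>1 v\<close> are the
  Bernstein--Bezier coefficients of the polynomial \<open>P\<close> with values \<open>v\<close> at the domain points, then,
  all basis polynomials having integral \<open>A\<^sub>T / N\<close> with \<open>N = (d + 2) choose 2\<close>, the integral of \<open>P\<close>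
  is \<open>A\<^sub>T / N\<close> times the sum of the \<open>c\<close>, which is the sum of column sums of \<open>B\<^sup>-\<^sup>1\<close> against
  \<open>v\<close>. The quadrature error is therefore the integral of \<open>f - P\<close>, to which Hoelder's inequality
  and the interpolation estimate apply. The matrix \<open>B\<close> is invertible because Lagrange polynomials
  at the domain points, written in barycentric coordinates and homogenized, give a right inverse.\<close>

section \<open>Integration over a triangle\<close>

text \<open>Euler's beta integral at integer exponents, scaled to \<open>{0..c}\<close>. Induction
  on \<open>n\<close> is integration by parts: each step trades one factor \<open>c - s\<close> for
  one factor \<open>s\<close>.\<close>

lemma has_integral_power_times_power:
  fixes c :: real
  assumes "0 \<le> c"
  shows "((\<lambda>s. s ^ m * (c - s) ^ n) has_integral
    fact m * fact n / fact (m + n + 1) * c ^ (m + n + 1)) {0..c}"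
proof (induction n arbitrary: m)
  case 0
  have "((\<lambda>s. s ^ m) has_integral c ^ Suc m / real (Suc m) - 0 ^ Suc m / real (Suc m)) {0..c}"
    using assms
    by (intro fundamental_theorem_of_calculus)
       (auto intro!: derivative_eq_intros simp flip: has_real_derivative_iff_has_vector_derivative
             simp del: power_Suc of_nat_Suc)
  then show ?case by (simp del: of_nat_Suc)
next
  case (Suc n)
  define I where "I = real (Suc n) / real (Suc m) *
    (fact (Suc m) * fact n / fact (Suc m + n + 1) * c ^ (Suc m + n + 1))"
  have IH: "((\<lambda>s. real (Suc n) / real (Suc m) * (s ^ Suc m * (c - s) ^ n)) has_integral I) {0..c}"
    unfolding I_def by (rule has_integral_mult_right[OF Suc.IH[of "Suc m"]])
  \<comment> \<open>The integrand is the derivative of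
    \<open>s ^ Suc m * (c - s) ^ Suc n / real (Suc m)\<close>, which vanishes at both ends of the
    interval.\<close>
  have "((\<lambda>s. s ^ m * (c - s) ^ Suc n - real (Suc n) / real (Suc m) * (s ^ Suc m * (c - s) ^ n))
    has_integral (c ^ Suc m * (c - c) ^ Suc n / real (Suc m) - 0 ^ Suc m * (c - 0) ^ Suc n / real (Suc m)))
    {0..c}"
    using assms
    apply (intro fundamental_theorem_of_calculus)
     apply simp
    apply (simp only: flip: has_real_derivative_iff_has_vector_derivative)
    apply (rule derivative_eq_intros refl | simp del: of_nat_Suc)+
    by (simp add: field_simps)
  from has_integral_add[OF this IH]
  have "((\<lambda>s. s ^ m * (c - s) ^ Suc n) has_integral I) {0..c}"
    by simp
  moreover have "I = real (Suc n) / real (Suc m) * (fact (Suc m) * fact n) /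
      fact (m + Suc n + 1) * c ^ (m + Suc n + 1)"
    by (simp add: I_def del: of_nat_Suc fact_Suc power_Suc)
  moreover have "real (Suc n) / real (Suc m) * (fact (Suc m) * fact n) = fact m * fact (Suc n)"
    by (simp del: of_nat_Suc)
  ultimately show ?case by (simp only:)
qed

lemma nn_integral_power_times_power:
  fixes c :: real
  assumes "0 \<le> c"
  shows "(\<integral>\<^sup>+ s. ennreal (s ^ m * (c - s) ^ n) * indicator {0..c} s \<partial>lborel)
    = ennreal (fact m * fact n / fact (m + n + 1) * c ^ (m + n + 1))"
  by (rule nn_integral_has_integral_lebesgue'[OF _ has_integral_power_times_power[OF assms]]) auto

text \<open>The Dirichlet integral as two nested beta integrals: the inner one over
  \<open>{0..1 - t}\<close> leaves a factor \<open>(1 - t) ^ (i + j + 1)\<close>, so the outer one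
  is a beta integral with \<open>c = 1\<close>, and \<open>fact (i + j + 1)\<close> cancels between
  the two.\<close>

lemma nn_integral_standard_simplex:
  "(\<integral>\<^sup>+ t. \<integral>\<^sup>+ s. ennreal ((1 - s - t) ^ i * s ^ j * t ^ k) *
      indicator {(s, t). 0 \<le> s \<and> 0 \<le> t \<and> s + t \<le> 1} (s, t) \<partial>lborel \<partial>(lborel :: real measure))
    = ennreal (fact i * fact j * fact k / fact (i + j + k + 2))"
proof -
  have inner: "(\<integral>\<^sup>+ s. ennreal ((1 - s - t) ^ i * s ^ j * t ^ k) *
      indicator {(s, t). 0 \<le> s \<and> 0 \<le> t \<and> s + t \<le> 1} (s, t) \<partial>lborel)
    = ennreal (fact i * fact j / fact (i + j + 1)) *
      (ennreal (t ^ k * (1 - t) ^ (i + j + 1)) * indicator {0..1} t)" (is "?L = ?R") for t :: real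
  proof (cases "t \<in> {0..1}")
    case True
    have "?L = (\<integral>\<^sup>+ s. ennreal (t ^ k) *
        (ennreal (s ^ j * ((1 - t) - s) ^ i) * indicator {0..1 - t} s) \<partial>lborel)"
      using True
      by (intro nn_integral_cong)
         (auto simp: indicator_def ennreal_mult'[symmetric] algebra_simps)
    also have "\<dots> = ennreal (t ^ k) * ennreal (fact j * fact i / fact (j + i + 1) * (1 - t) ^ (j + i + 1))"
      using True by (subst nn_integral_cmult) (measurable, simp add: nn_integral_power_times_power)
    also have "\<dots> = ?R"
      using True by (simp add: ennreal_mult'[symmetric] ac_simps)
    finally show ?thesis .
  next
    case False
    then have "?L = (\<integral>\<^sup>+ s. 0 \<partial>(lborel :: real measure))"
      by (intro nn_integral_cong) (auto simp: indicator_def)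
    with False show ?thesis by simp
  qed
  show ?thesis
    unfolding inner
    by (subst nn_integral_cmult)
       (simp_all only: nn_integral_power_times_power zero_le_one, auto simp: ennreal_mult'[symmetric] ac_simps)
qed

section \<open>Affine change of variables in the plane\<close>

text \<open>By Tonelli, two one-dimensional affine substitutions suffice: \<open>y\<close> in terms
  of \<open>t\<close> at fixed \<open>x\<close>, with factor \<open>D / u1\<close>, then
  \<open>x\<close> in terms of \<open>s\<close> at fixed \<open>t\<close>, with factor
  \<open>u1\<close>. Their product is the determinant.\<close>

lemma nn_integral_affine_plane_aux:
  fixes g :: "real \<times> real \<Rightarrow> ennreal"
  assumes [measurable]: "g \<in> borel_measurable borel" and "u1 \<noteq> 0" and D: "u1 * w2 - w1 * u2 \<noteq> 0"
  shows "(\<integral>\<^sup>+ z. g z \<partial>lborel) =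
    ennreal \<bar>u1 * w2 - w1 * u2\<bar> *
      (\<integral>\<^sup>+ t. \<integral>\<^sup>+ s. g (x1 + s * u1 + t * w1, y1 + s * u2 + t * w2) \<partial>lborel \<partial>lborel)"
proof -
  define D where "D = u1 * w2 - w1 * u2"
  have [measurable]: "g \<in> borel_measurable (lborel \<Otimes>\<^sub>M lborel)"
    by (simp add: lborel_prod)
  have m: "(\<lambda>(x, t). g (x, y1 + u2 / u1 * (x - x1) + D / u1 * t)) \<in> borel_measurable (lborel \<Otimes>\<^sub>M lborel)"
    by measurable
  have "(\<integral>\<^sup>+ z. g z \<partial>lborel) = (\<integral>\<^sup>+ x. \<integral>\<^sup>+ y. g (x, y) \<partial>lborel \<partial>lborel)"
    by (simp add: lborel_prod[symmetric] lborel.nn_integral_fst)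
  \<comment> \<open>Solving \<open>x = x1 + s * u1 + t * w1\<close> for \<open>s\<close> and
    inserting it into the second coordinate gives an affine function of \<open>t\<close> with slope
    \<open>D / u1\<close>.\<close>
  also have "\<dots> = (\<integral>\<^sup>+ x. ennreal \<bar>D / u1\<bar> *
      (\<integral>\<^sup>+ t. g (x, y1 + u2 / u1 * (x - x1) + D / u1 * t) \<partial>lborel) \<partial>lborel)"
    using assms by (intro nn_integral_cong nn_integral_real_affine) (auto simp: D_def)
  also have "\<dots> = ennreal \<bar>D / u1\<bar> *
      (\<integral>\<^sup>+ x. \<integral>\<^sup>+ t. g (x, y1 + u2 / u1 * (x - x1) + D / u1 * t) \<partial>lborel \<partial>lborel)"
    by (rule nn_integral_cmult) measurable
  also have "(\<integral>\<^sup>+ x. \<integral>\<^sup>+ t. g (x, y1 + u2 / u1 * (x - x1) + D / u1 * t) \<partial>lborel \<partial>lborel)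
     = (\<integral>\<^sup>+ t. \<integral>\<^sup>+ x. g (x, y1 + u2 / u1 * (x - x1) + D / u1 * t) \<partial>lborel \<partial>lborel)"
    using lborel_pair.Fubini'[OF m] by simp
  also have "\<dots> = (\<integral>\<^sup>+ t. ennreal \<bar>u1\<bar> *
      (\<integral>\<^sup>+ s. g (x1 + s * u1 + t * w1, y1 + s * u2 + t * w2) \<partial>lborel) \<partial>lborel)"
  proof (intro nn_integral_cong)
    fix t :: real
    have eq: "y1 + u2 / u1 * (x1 + t * w1 + u1 * s - x1) + D / u1 * t = y1 + s * u2 + t * w2" for s
      using \<open>u1 \<noteq> 0\<close> by (simp add: D_def field_simps)
    have "(\<integral>\<^sup>+ x. g (x, y1 + u2 / u1 * (x - x1) + D / u1 * t) \<partial>lborel) = ennreal \<bar>u1\<bar> *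
      (\<integral>\<^sup>+ s. g (x1 + t * w1 + u1 * s, y1 + u2 / u1 * (x1 + t * w1 + u1 * s - x1) + D / u1 * t) \<partial>lborel)"
      using \<open>u1 \<noteq> 0\<close> by (intro nn_integral_real_affine) auto
    then show "(\<integral>\<^sup>+ x. g (x, y1 + u2 / u1 * (x - x1) + D / u1 * t) \<partial>lborel) = ennreal \<bar>u1\<bar> *
      (\<integral>\<^sup>+ s. g (x1 + s * u1 + t * w1, y1 + s * u2 + t * w2) \<partial>lborel)"
      unfolding eq by (simp add: ac_simps)
  qed
  also have "\<dots> = ennreal \<bar>u1\<bar> *
      (\<integral>\<^sup>+ t. \<integral>\<^sup>+ s. g (x1 + s * u1 + t * w1, y1 + s * u2 + t * w2) \<partial>lborel \<partial>lborel)"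
    by (rule nn_integral_cmult) measurable
  finally show ?thesis
    using \<open>u1 \<noteq> 0\<close> by (simp add: mult.assoc[symmetric] ennreal_mult'[symmetric] D_def[symmetric])
qed

text \<open>If \<open>u1 = 0\<close>, the determinant forces \<open>u2 \<noteq> 0\<close>, and
  exchanging the two coordinates of the plane reduces to the previous case; the determinant only
  changes its sign.\<close>

lemma nn_integral_affine_plane:
  fixes g :: "real \<times> real \<Rightarrow> ennreal"
  assumes [measurable]: "g \<in> borel_measurable borel" and D: "u1 * w2 - w1 * u2 \<noteq> 0"
  shows "(\<integral>\<^sup>+ z. g z \<partial>lborel) =
    ennreal \<bar>u1 * w2 - w1 * u2\<bar> *
      (\<integral>\<^sup>+ t. \<integral>\<^sup>+ s. g (x1 + s * u1 + t * w1, y1 + s * u2 + t * w2) \<partial>lborel \<partial>lborel)"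
proof (cases "u1 = 0")
  case False
  then show ?thesis using assms by (intro nn_integral_affine_plane_aux)
next
  case True
  have [measurable]: "g \<in> borel_measurable (lborel \<Otimes>\<^sub>M lborel)"
    by (simp add: lborel_prod)
  have "(\<lambda>(y, x). g (x, y)) \<in> borel_measurable (lborel \<Otimes>\<^sub>M lborel)"
    by measurable
  then have [measurable]: "(\<lambda>(y, x). g (x, y)) \<in> borel_measurable borel"
    by (simp add: lborel_prod)
  have "(\<integral>\<^sup>+ z. g z \<partial>lborel) = (\<integral>\<^sup>+ y. \<integral>\<^sup>+ x. g (x, y) \<partial>lborel \<partial>lborel)"
    by (simp add: lborel_prod[symmetric] lborel_pair.nn_integral_snd)
  also have "\<dots> = (\<integral>\<^sup>+ z. (\<lambda>(y, x). g (x, y)) z \<partial>lborel)"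
    by (subst lborel_prod[symmetric], subst lborel.nn_integral_fst[symmetric]) auto
  also have "\<dots> = ennreal \<bar>u2 * w1 - w2 * u1\<bar> *
      (\<integral>\<^sup>+ t. \<integral>\<^sup>+ s. (\<lambda>(y, x). g (x, y)) (y1 + s * u2 + t * w2, x1 + s * u1 + t * w1) \<partial>lborel \<partial>lborel)"
    using True D by (intro nn_integral_affine_plane_aux) (auto simp: algebra_simps)
  finally show ?thesis
    by (simp add: abs_minus_commute ac_simps)
qed

section \<open>Hoelder's inequality\<close>

text \<open>Bernoulli's inequality with a real exponent: a convex power lies above its tangent at 1.
  For positive \<open>x\<close> it is Young's inequality for \<open>x powr P\<close> and 1 with
  weights \<open>1 / P\<close> and \<open>1 - 1 / P\<close>, multiplied by \<open>P\<close>.\<close>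

lemma powr_ge_tangent:
  fixes x P :: real
  assumes "0 \<le> x" "1 \<le> P"
  shows "1 + P * (x - 1) \<le> x powr P"
proof (cases "x = 0")
  case False
  then have "(x powr P) powr (1 / P) * 1 powr (1 - 1 / P) \<le> 1 / P * x powr P + (1 - 1 / P) * 1"
    using assms False by (intro Youngs_inequality_0) (auto simp: divide_simps)
  then have "x \<le> 1 / P * x powr P + (1 - 1 / P)"
    using assms False by (simp add: powr_powr)
  then have "P * x \<le> P * (1 / P * x powr P + (1 - 1 / P))"
    using assms by (intro mult_left_mono) auto
  also have "\<dots> = x powr P + P - 1"
    using assms by (simp add: field_simps)
  finally show ?thesis
    by (simp add: algebra_simps)
qed (use assms in auto)

text \<open>Both summands are at most 1, hence finite, so \<open>enn2real\<close> is additive on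
  them. Infinite exponents are covered, their reciprocal being 0.\<close>

lemma enn2real_conjugate_exponent:
  fixes p q :: ennreal
  assumes "1 / p + 1 / q = 1"
  shows "enn2real (1 / q) = 1 - enn2real (1 / p)"
proof -
  have "1 / p \<le> 1 / p + 1 / q" "1 / q \<le> 1 / p + 1 / q"
    by (simp_all add: add_increasing add_increasing2)
  then have "1 / p < \<infinity>" "1 / q < \<infinity>"
    unfolding assms by (auto simp: order_le_less_trans)
  then have "enn2real (1 / p) + enn2real (1 / q) = enn2real (1 / p + 1 / q)"
    by (simp add: enn2real_plus)
  then show ?thesis
    unfolding assms by simp
qed

lemma enn2real_ge_1:
  assumes "1 \<le> p" "p \<noteq> \<infinity>"
  shows "1 \<le> enn2real p"
  using enn2real_mono[of 1 p] assms by (simp add: top.not_eq_extremum)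

text \<open>On a set of finite measure an essentially bounded function is integrable, and for a
  finite exponent \<open>P\<close> the function is dominated by
  \<open>1 + \<bar>g z\<bar> powr P\<close>.\<close>

lemma integrable_Lp_space:
  assumes S: "S \<in> lmeasurable" and "1 \<le> p" and g: "g \<in> Lp_space p S"
  shows "integrable (lebesgue_on S) g"
proof -
  interpret finite_measure "lebesgue_on S"
    using S by (rule finite_measure_lebesgue_on)
  have meas [measurable]: "g \<in> borel_measurable (lebesgue_on S)"
    using g by (simp add: Lp_space_def)
  show ?thesis
  proof (cases "p = \<infinity>")
    case True
    define N where "N = esssup (lebesgue_on S) (\<lambda>z. ennreal \<bar>g z\<bar>)"
    have "N < \<infinity>"
      using g True by (simp add: Lp_space_def N_def)
    moreover have "AE z in lebesgue_on S. ennreal \<bar>g z\<bar> \<le> N"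
      unfolding N_def by (rule esssup_AE)
    ultimately have "AE z in lebesgue_on S. norm (g z) \<le> enn2real N"
      by (auto elim!: eventually_mono dest: enn2real_mono)
    then show ?thesis
      by (intro integrable_const_bound) auto
  next
    case False
    define P where "P = enn2real p"
    have P: "1 \<le> P"
      using \<open>1 \<le> p\<close> False by (simp add: P_def enn2real_ge_1)
    have int: "integrable (lebesgue_on S) (\<lambda>z. \<bar>g z\<bar> powr P)"
      using g False by (simp add: Lp_space_def P_def)
    have "\<bar>x\<bar> \<le> 1 + \<bar>x\<bar> powr P" for x :: real
    proof (cases "\<bar>x\<bar> \<le> 1")
      case False
      then show ?thesis using powr_mono[of 1 P "\<bar>x\<bar>"] P by simp
    qed (simp add: add_increasing2)
    then show ?thesis
      using int by (intro Bochner_Integration.integrable_bound[of _ "\<lambda>z. 1 + \<bar>g z\<bar> powr P" g]) auto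
  qed
qed

text \<open>Hoelder's inequality against the constant function 1. For finite \<open>p\<close> it is
  obtained as Jensen's inequality, by integrating a tangent of the power function; this treats the
  exponent 1 together with the others.\<close>

lemma abs_integral_le_Lp_norm:
  assumes S: "S \<in> lmeasurable" "measure lebesgue S > 0"
    and p: "1 \<le> p" "1 / p + 1 / q = 1" and g: "g \<in> Lp_space p S"
  shows "\<bar>\<integral>z. g z \<partial>lebesgue_on S\<bar> \<le> measure lebesgue S powr enn2real (1 / q) * Lp_norm p S g"
proof -
  define A where "A = measure lebesgue S"
  interpret finite_measure "lebesgue_on S"
    using S(1) by (rule finite_measure_lebesgue_on)
  have meas [measurable]: "g \<in> borel_measurable (lebesgue_on S)"
    using g by (simp add: Lp_space_def)
  have S': "S \<in> sets lebesgue"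
    using S(1) by (rule fmeasurableD)
  have A: "measure (lebesgue_on S) (space (lebesgue_on S)) = A" "A > 0"
    using S S' by (simp_all add: A_def measure_restrict_space)
  have int_g: "integrable (lebesgue_on S) g"
    using S(1) p(1) g by (rule integrable_Lp_space)
  have le: "\<bar>\<integral>z. g z \<partial>lebesgue_on S\<bar> \<le> (\<integral>z. \<bar>g z\<bar> \<partial>lebesgue_on S)"
    by (rule integral_abs_bound)
  show ?thesis
  proof (cases "p = \<infinity>")
    case True
    define N where "N = esssup (lebesgue_on S) (\<lambda>z. ennreal \<bar>g z\<bar>)"
    have "N < \<infinity>"
      using g True by (simp add: Lp_space_def N_def)
    moreover have "AE z in lebesgue_on S. ennreal \<bar>g z\<bar> \<le> N"
      unfolding N_def by (rule esssup_AE)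
    ultimately have "AE z in lebesgue_on S. \<bar>g z\<bar> \<le> enn2real N"
      by (auto elim!: eventually_mono dest: enn2real_mono)
    then have "(\<integral>z. \<bar>g z\<bar> \<partial>lebesgue_on S) \<le> (\<integral>z. enn2real N \<partial>lebesgue_on S)"
      using int_g by (intro integral_mono_AE) auto
    also have "\<dots> = A * enn2real N"
      using A by simp
    also have "\<dots> = A powr enn2real (1 / q) * Lp_norm p S g"
    proof -
      have "1 / q = 1"
        using p(2) True by simp
      then show ?thesis
        using True A by (simp add: Lp_norm_def N_def)
    qed
    finally show ?thesis
      using le unfolding A_def by (rule order_trans[rotated])
  next
    case False
    define P where "P = enn2real p"
    have P: "1 \<le> P"
      using \<open>1 \<le> p\<close> False by (simp add: P_def enn2real_ge_1)
    have int: "integrable (lebesgue_on S) (\<lambda>z. \<bar>g z\<bar> powr P)"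
      using g False by (simp add: Lp_space_def P_def)
    define m where "m = (\<integral>z. \<bar>g z\<bar> \<partial>lebesgue_on S) / A"
    have "m \<ge> 0"
      using A by (simp add: m_def)
    have int_eq: "(\<integral>z. \<bar>g z\<bar> \<partial>lebesgue_on S) = A * m"
      using A by (simp add: m_def)
    have "A * m powr P \<le> (\<integral>z. \<bar>g z\<bar> powr P \<partial>lebesgue_on S)"
    proof (cases "m = 0")
      case False
      then have "m > 0" using \<open>m \<ge> 0\<close> by simp
      \<comment> \<open>The tangent is taken at the mean \<open>m\<close> of
        \<open>\<bar>g z\<bar>\<close>, so its linear term integrates to 0 and only
        \<open>A * m powr P\<close> remains.\<close>
      have tangent: "m powr P * (1 + P * (\<bar>g z\<bar> / m - 1)) \<le> \<bar>g z\<bar> powr P" for z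
        using powr_ge_tangent[of "\<bar>g z\<bar> / m" P] P \<open>m > 0\<close>
        by (simp add: powr_divide field_simps)
      have "A * m powr P = (\<integral>z. m powr P * (1 + P * (\<bar>g z\<bar> / m - 1)) \<partial>lebesgue_on S)"
        using int_g A \<open>m > 0\<close> by (simp add: int_eq field_simps)
      also have "\<dots> \<le> (\<integral>z. \<bar>g z\<bar> powr P \<partial>lebesgue_on S)"
        using int int_g tangent by (intro integral_mono) auto
      finally show ?thesis .
    qed simp
    then have "(A * m powr P) powr (1 / P) \<le> Lp_norm p S g"
      using False P A by (simp add: Lp_norm_def P_def powr_mono2)
    then have "A powr (1 / P) * m \<le> Lp_norm p S g"
      using P \<open>m \<ge> 0\<close> A by (cases "m = 0") (simp_all add: powr_mult powr_powr)
    then have "A powr (1 - 1 / P) * (A powr (1 / P) * m) \<le> A powr (1 - 1 / P) * Lp_norm p S g"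
      by (rule mult_left_mono) simp
    moreover have "A powr (1 - 1 / P) * (A powr (1 / P) * m) = A * m"
      using A by (simp add: mult.assoc[symmetric] powr_add[symmetric])
    moreover have "enn2real (1 / q) = 1 - 1 / P"
    proof -
      have "p = ennreal P"
        using False by (simp add: P_def less_top)
      then have "1 / p = ennreal (1 / P)"
        using P by (simp add: divide_ennreal flip: ennreal_1)
      then show ?thesis
        using enn2real_conjugate_exponent[OF p(2)] P by simp
    qed
    ultimately show ?thesis
      using le unfolding int_eq A_def[symmetric] by simp
  qed
qed

text \<open>This makes Hoelder's inequality applicable to the interpolation error, polynomials being
  bounded on the triangle. For finite exponents, the power of a difference is at most the power of
  twice the larger of the two absolute values.\<close>

lemma Lp_space_diff_bounded:
  assumes S: "S \<in> lmeasurable" and "1 \<le> p" and f: "f \<in> Lp_space p S"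
    and h [measurable]: "h \<in> borel_measurable (lebesgue_on S)"
    and bound: "\<And>z. z \<in> S \<Longrightarrow> \<bar>h z\<bar> \<le> M"
  shows "(\<lambda>z. f z - h z) \<in> Lp_space p S"
proof -
  interpret finite_measure "lebesgue_on S"
    using S by (rule finite_measure_lebesgue_on)
  have meas [measurable]: "f \<in> borel_measurable (lebesgue_on S)"
    using f by (simp add: Lp_space_def)
  show ?thesis
  proof (cases "p = \<infinity>")
    case True
    define N where "N = esssup (lebesgue_on S) (\<lambda>z. ennreal \<bar>f z\<bar>)"
    have "N < \<infinity>"
      using f True by (simp add: Lp_space_def N_def)
    have AE_f: "AE z in lebesgue_on S. ennreal \<bar>f z\<bar> \<le> N"
      unfolding N_def by (rule esssup_AE)
    have AE_h: "AE z in lebesgue_on S. ennreal \<bar>h z\<bar> \<le> ennreal M"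
      using bound by (intro AE_I2) (auto intro: ennreal_leI)
    from AE_f AE_h have "AE z in lebesgue_on S. ennreal \<bar>f z - h z\<bar> \<le> N + ennreal M"
    proof eventually_elim
      case (elim z)
      have "ennreal \<bar>f z - h z\<bar> \<le> ennreal (\<bar>f z\<bar> + \<bar>h z\<bar>)"
        by (intro ennreal_leI) simp
      also have "\<dots> = ennreal \<bar>f z\<bar> + ennreal \<bar>h z\<bar>"
        by simp
      also have "\<dots> \<le> N + ennreal M"
        using elim by (rule add_mono)
      finally show ?case .
    qed
    then have "esssup (lebesgue_on S) (\<lambda>z. ennreal \<bar>f z - h z\<bar>) \<le> N + ennreal M"
      by (intro esssup_I) measurable
    also have "\<dots> < \<infinity>"
      using \<open>N < \<infinity>\<close> by simp
    finally show ?thesis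
      using True by (simp add: Lp_space_def)
  next
    case False
    define P where "P = enn2real p"
    have P: "1 \<le> P"
      using \<open>1 \<le> p\<close> False by (simp add: P_def enn2real_ge_1)
    have int: "integrable (lebesgue_on S) (\<lambda>z. \<bar>f z\<bar> powr P)"
      using f False by (simp add: Lp_space_def P_def)
    have "\<bar>f z - h z\<bar> powr P \<le> 2 powr P * (\<bar>f z\<bar> powr P + \<bar>M\<bar> powr P)" if "z \<in> S" for z
    proof -
      have "\<bar>f z - h z\<bar> \<le> 2 * max \<bar>f z\<bar> \<bar>M\<bar>"
        using bound[OF that] by linarith
      then have "\<bar>f z - h z\<bar> powr P \<le> (2 * max \<bar>f z\<bar> \<bar>M\<bar>) powr P"
        using P by (intro powr_mono2) auto
      also have "\<dots> = 2 powr P * max \<bar>f z\<bar> \<bar>M\<bar> powr P"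
        by (rule powr_mult)
      also have "\<dots> \<le> 2 powr P * (\<bar>f z\<bar> powr P + \<bar>M\<bar> powr P)"
        by (intro mult_left_mono) (auto simp: max_def)
      finally show ?thesis .
    qed
    then have AE: "AE z in lebesgue_on S.
        norm (\<bar>f z - h z\<bar> powr P) \<le> norm (2 powr P * (\<bar>f z\<bar> powr P + \<bar>M\<bar> powr P))"
      by (intro AE_I2) simp
    have int2: "integrable (lebesgue_on S) (\<lambda>z. 2 powr P * (\<bar>f z\<bar> powr P + \<bar>M\<bar> powr P))"
      using int by simp
    have "integrable (lebesgue_on S) (\<lambda>z. \<bar>f z - h z\<bar> powr P)"
      by (rule Bochner_Integration.integrable_bound[OF int2 _ AE]) measurable
    then show ?thesis
      using False by (simp add: Lp_space_def P_def)
  qed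
qed

section \<open>Ternary forms and Lagrange interpolation\<close>

text \<open>Homogeneity in three variables serves twice: at barycentric coordinates the monomials
  are the Bernstein--Bezier polynomials up to constants, and setting the last variable to 1 leads to
  \<open>poly_space d\<close>.\<close>

definition ternary_forms :: "nat \<Rightarrow> (real \<Rightarrow> real \<Rightarrow> real \<Rightarrow> real) set" where
  "ternary_forms d = {g. \<exists>c. \<forall>x y z.
     g x y z = (\<Sum>(i, j, k) \<in> multi_indices d. c (i, j, k) * (x ^ i * y ^ j * z ^ k))}"

lemma finite_multi_indices [simp]: "finite (multi_indices d)"
  by (metis List.finite_set set_index_list)

lemma ternary_formsE:
  assumes "g \<in> ternary_forms d"
  obtains c where
    "\<And>x y z. g x y z = (\<Sum>(i, j, k) \<in> multi_indices d. c (i, j, k) * (x ^ i * y ^ j * z ^ k))"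
  using assms unfolding ternary_forms_def by blast

lemma monomial_in_ternary_forms:
  assumes "i + j + k = d"
  shows "(\<lambda>x y z. x ^ i * y ^ j * z ^ k) \<in> ternary_forms d"
proof -
  have "x ^ i * y ^ j * z ^ k =
      (\<Sum>t \<in> multi_indices d. if t = (i, j, k) then x ^ i * y ^ j * z ^ k else 0)" for x y z :: real
    using assms sum.delta[OF finite_multi_indices, where a = "(i, j, k)" and b = "\<lambda>_. x ^ i * y ^ j * z ^ k"]
    by (simp add: multi_indices_def)
  also have "\<dots> x y z = (\<Sum>(i', j', k') \<in> multi_indices d.
      (if (i', j', k') = (i, j, k) then 1 else 0) * (x ^ i' * y ^ j' * z ^ k'))" for x y z :: real
    by (intro sum.cong refl) (simp split: prod.split)
  finally show ?thesis
    unfolding ternary_forms_def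
    by (intro CollectI exI[of _ "\<lambda>t. if t = (i, j, k) then 1 else 0"] allI)
qed

lemma sum_in_ternary_forms:
  assumes "\<And>t. t \<in> A \<Longrightarrow> h t \<in> ternary_forms d"
  shows "(\<lambda>x y z. \<Sum>t \<in> A. a t * h t x y z) \<in> ternary_forms d"
proof -
  have "\<exists>c. \<forall>t \<in> A. \<forall>x y z.
      h t x y z = (\<Sum>(i, j, k) \<in> multi_indices d. c t (i, j, k) * (x ^ i * y ^ j * z ^ k))"
    using assms by (intro bchoice) (simp add: ternary_forms_def)
  then obtain c where c: "\<And>t x y z. t \<in> A \<Longrightarrow>
      h t x y z = (\<Sum>(i, j, k) \<in> multi_indices d. c t (i, j, k) * (x ^ i * y ^ j * z ^ k))"
    by blast
  have "(\<Sum>t \<in> A. a t * h t x y z) = (\<Sum>t \<in> A. \<Sum>(i, j, k) \<in> multi_indices d.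
      a t * c t (i, j, k) * (x ^ i * y ^ j * z ^ k))" for x y z
    by (intro sum.cong) (auto simp: c sum_distrib_left mult.assoc intro!: sum.cong)
  also have "\<dots> x y z = (\<Sum>(i, j, k) \<in> multi_indices d.
      (\<Sum>t \<in> A. a t * c t (i, j, k)) * (x ^ i * y ^ j * z ^ k))" for x y z
    by (subst sum.swap) (auto simp: sum_distrib_right intro!: sum.cong)
  finally show ?thesis
    unfolding ternary_forms_def
    by (intro CollectI exI[of _ "\<lambda>s. \<Sum>t \<in> A. a t * c t s"] allI)
qed

lemma scale_in_ternary_forms:
  "g \<in> ternary_forms d \<Longrightarrow> (\<lambda>x y z. a * g x y z) \<in> ternary_forms d"
  using sum_in_ternary_forms[of "{()}" "\<lambda>_. g" d "\<lambda>_. a"] by simp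

lemma add_in_ternary_forms:
  assumes "g \<in> ternary_forms d" "h \<in> ternary_forms d"
  shows "(\<lambda>x y z. g x y z + h x y z) \<in> ternary_forms d"
proof -
  have "(\<lambda>x y z. \<Sum>b \<in> {True, False}. 1 * (if b then g else h) x y z) \<in> ternary_forms d"
    using assms by (intro sum_in_ternary_forms) auto
  then show ?thesis by simp
qed

text \<open>Distributing the linear form over a monomial raises one of the three exponents at a
  time, so each monomial of degree \<open>d\<close> yields three of degree
  \<open>Suc d\<close>.\<close>

lemma linear_mult_in_ternary_forms:
  assumes "g \<in> ternary_forms d"
  shows "(\<lambda>x y z. (a * x + b * y + e * z) * g x y z) \<in> ternary_forms (Suc d)"
proof -
  obtain c where c: "\<And>x y z.
      g x y z = (\<Sum>(i, j, k) \<in> multi_indices d. c (i, j, k) * (x ^ i * y ^ j * z ^ k))"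
    using ternary_formsE[OF assms] by blast
  define h :: "index \<Rightarrow> real \<Rightarrow> real \<Rightarrow> real \<Rightarrow> real" where
    "h = (\<lambda>(i, j, k) x y z. a * (x ^ Suc i * y ^ j * z ^ k) + b * (x ^ i * y ^ Suc j * z ^ k)
      + e * (x ^ i * y ^ j * z ^ Suc k))"
  have "h t \<in> ternary_forms (Suc d)" if t_in: "t \<in> multi_indices d" for t
  proof -
    obtain i j k where t: "t = (i, j, k)" "i + j + k = d"
      using t_in by (cases t) (auto simp: multi_indices_def)
    have "(\<lambda>x y z. x ^ Suc i * y ^ j * z ^ k) \<in> ternary_forms (Suc d)"
      "(\<lambda>x y z. x ^ i * y ^ Suc j * z ^ k) \<in> ternary_forms (Suc d)"
      "(\<lambda>x y z. x ^ i * y ^ j * z ^ Suc k) \<in> ternary_forms (Suc d)"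
      using t(2) by (auto intro!: monomial_in_ternary_forms simp del: power_Suc)
    then show ?thesis
      unfolding h_def t(1) prod.case by (intro add_in_ternary_forms scale_in_ternary_forms)
  qed
  then have "(\<lambda>x y z. \<Sum>t \<in> multi_indices d. c t * h t x y z) \<in> ternary_forms (Suc d)"
    by (rule sum_in_ternary_forms)
  also have "(\<lambda>x y z. \<Sum>t \<in> multi_indices d. c t * h t x y z)
      = (\<lambda>x y z. (a * x + b * y + e * z) * g x y z)"
    by (intro ext) (auto simp: c sum_distrib_left h_def algebra_simps intro!: sum.cong)
  finally show ?thesis .
qed

lemma linear_prod_mult_in_ternary_forms:
  assumes "g \<in> ternary_forms d"
  shows "(\<lambda>x y z. (\<Prod>m<n. a m * x + b m * y + e m * z) * g x y z) \<in> ternary_forms (n + d)"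
proof (induction n)
  case (Suc n)
  show ?case
    using linear_mult_in_ternary_forms[OF Suc, of "a n" "b n" "e n"]
    by (simp add: ac_simps)
qed (use assms in simp)

lemma one_in_ternary_forms: "(\<lambda>x y z. 1) \<in> ternary_forms 0"
  using monomial_in_ternary_forms[of 0 0 0 0] by simp

lemma linear_power_mult_in_ternary_forms:
  assumes "g \<in> ternary_forms d"
  shows "(\<lambda>x y z. (a * x + b * y + e * z) ^ n * g x y z) \<in> ternary_forms (n + d)"
  using linear_prod_mult_in_ternary_forms[OF assms, of "\<lambda>_. a" "\<lambda>_. b" "\<lambda>_. e" n] by simp

section \<open>Passage to bivariate polynomials\<close>

text \<open>Dropping the third exponent is a bijection from \<open>multi_indices d\<close> to the
  pairs with \<open>i + j \<le> d\<close>; the lost exponent is recovered as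
  \<open>d - i - j\<close>.\<close>

lemma dehomogenize_in_poly_space:
  assumes "g \<in> ternary_forms d"
  shows "(\<lambda>(x, y). g x y 1) \<in> poly_space d"
proof -
  obtain c where c: "\<And>x y z.
      g x y z = (\<Sum>(i, j, k) \<in> multi_indices d. c (i, j, k) * (x ^ i * y ^ j * z ^ k))"
    using ternary_formsE[OF assms] by blast
  have "g x y 1 = (\<Sum>(i, j) \<in> {(i, j). i + j \<le> d}. c (i, j, d - i - j) * x ^ i * y ^ j)" for x y
    unfolding c
    by (rule sum.reindex_bij_witness[where i = "\<lambda>(i, j). (i, j, d - i - j)" and j = "\<lambda>(i, j, k). (i, j)"])
       (auto simp: multi_indices_def)
  then show ?thesis
    unfolding poly_space_def by (intro CollectI exI[of _ "\<lambda>i j. c (i, j, d - i - j)"]) simp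
qed

lemma poly_space_sum:
  assumes "\<And>t. t \<in> A \<Longrightarrow> P t \<in> poly_space d"
  shows "(\<lambda>z. \<Sum>t \<in> A. a t * P t z) \<in> poly_space d"
proof -
  have "\<exists>c. \<forall>t \<in> A. \<forall>x y.
      P t (x, y) = (\<Sum>(i, j) \<in> {(i, j). i + j \<le> d}. c t i j * x ^ i * y ^ j)"
    using assms by (intro bchoice) (simp add: poly_space_def)
  then obtain c where c: "\<And>t x y. t \<in> A \<Longrightarrow>
      P t (x, y) = (\<Sum>(i, j) \<in> {(i, j). i + j \<le> d}. c t i j * x ^ i * y ^ j)"
    by blast
  have "(\<Sum>t \<in> A. a t * P t (x, y)) = (\<Sum>t \<in> A. \<Sum>(i, j) \<in> {(i, j). i + j \<le> d}.
      a t * c t i j * x ^ i * y ^ j)" for x y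
    by (intro sum.cong) (auto simp: c sum_distrib_left mult.assoc intro!: sum.cong)
  also have "\<dots> x y = (\<Sum>(i, j) \<in> {(i, j). i + j \<le> d}. (\<Sum>t \<in> A. a t * c t i j) * x ^ i * y ^ j)" for x y
    by (subst sum.swap) (auto simp: sum_distrib_right intro!: sum.cong)
  finally show ?thesis
    unfolding poly_space_def
    by (intro CollectI exI[of _ "\<lambda>i j. \<Sum>t \<in> A. a t * c t i j"] allI)
qed

lemma continuous_on_poly_space:
  assumes "P \<in> poly_space d"
  shows "continuous_on S P"
proof -
  obtain c where c: "\<And>x y. P (x, y) = (\<Sum>(i, j) \<in> {(i, j). i + j \<le> d}. c i j * x ^ i * y ^ j)"
    using assms unfolding poly_space_def by blast
  have "P = (\<lambda>z. \<Sum>(i, j) \<in> {(i, j). i + j \<le> d}. c i j * fst z ^ i * snd z ^ j)"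
    by (auto simp: fun_eq_iff c)
  then show ?thesis
    by (simp only: case_prod_unfold) (intro continuous_intros)
qed

text \<open>The constant terms of the Lagrange factors are multiplied by \<open>x + y + z\<close>, which is \<open>1\<close> at
  barycentric coordinates; this makes the product homogeneous of degree \<open>d\<close>.\<close>

lemma lagrange_ternary_form:
  assumes t: "t \<in> multi_indices d" and "d \<ge> 1"
  obtains g where "g \<in> ternary_forms d"
    and "\<And>i j k. (i, j, k) \<in> multi_indices d \<Longrightarrow>
      g (real i / real d) (real j / real d) (real k / real d) = (if (i, j, k) = t then 1 else 0)"
proof -
  obtain i0 j0 k0 where t_eq: "t = (i0, j0, k0)" and sum0: "i0 + j0 + k0 = d"
    using t by (cases t) (auto simp: multi_indices_def)
  \<comment> \<open>By the identities \<open>expand\<close> below, each factor is \<open>d\<close>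
    times one variable minus \<open>m * (x + y + z)\<close>. The final factor 1 is the form of
    degree 0 from which the products are built up.\<close>
  define L where "L x y z =
    (\<Prod>m<i0. (real d - real m) * x + (- real m) * y + (- real m) * z) *
    ((\<Prod>m<j0. (- real m) * x + (real d - real m) * y + (- real m) * z) *
    ((\<Prod>m<k0. (- real m) * x + (- real m) * y + (real d - real m) * z) * 1))" for x y z
  have "L \<in> ternary_forms (i0 + (j0 + (k0 + 0)))"
    unfolding L_def
    by (intro linear_prod_mult_in_ternary_forms one_in_ternary_forms)
  then have L: "L \<in> ternary_forms d"
    using sum0 by (simp add: add.assoc)
  have val: "L (real i / d) (real j / d) (real k / d) =
      (\<Prod>m<i0. real i - real m) * ((\<Prod>m<j0. real j - real m) * (\<Prod>m<k0. real k - real m))"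
    if "i + j + k = d" for i j k
  proof -
    have sum_1: "real i / d + real j / d + real k / d = 1"
      using \<open>d \<ge> 1\<close> by (simp add: add_divide_distrib[symmetric] flip: that)
    have cancel: "real d * (real i / d) = i" "real d * (real j / d) = j" "real d * (real k / d) = k"
      using \<open>d \<ge> 1\<close> by simp_all
    have expand: "(c - m) * x + (- m) * y + (- m) * z = c * x - m * (x + y + z)"
        "(- m) * x + (c - m) * y + (- m) * z = c * y - m * (x + y + z)"
        "(- m) * x + (- m) * y + (c - m) * z = c * z - m * (x + y + z)" for c m x y z :: real
      by (simp_all add: algebra_simps)
    have "(real d - m) * (real i / d) + (- m) * (real j / d) + (- m) * (real k / d) = real i - m"
         "(- m) * (real i / d) + (real d - m) * (real j / d) + (- m) * (real k / d) = real j - m"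
         "(- m) * (real i / d) + (- m) * (real j / d) + (real d - m) * (real k / d) = real k - m" for m :: real
      unfolding expand sum_1 cancel by simp_all
    then show ?thesis
      unfolding L_def by simp
  qed
  have zero: "(\<Prod>m<n. real i - real m) = 0 \<longleftrightarrow> i < n" for i n
    by auto
  \<comment> \<open>The value of \<open>L\<close> at its own node is
    \<open>fact i0 * fact j0 * fact k0\<close>, so the normalization is legitimate.\<close>
  define g where "g x y z = inverse (L (real i0 / d) (real j0 / d) (real k0 / d)) * L x y z" for x y z
  have "g \<in> ternary_forms d"
    unfolding g_def by (rule scale_in_ternary_forms[OF L])
  moreover have "g (real i / d) (real j / d) (real k / d) = (if (i, j, k) = t then 1 else 0)"
    if "(i, j, k) \<in> multi_indices d" for i j k
  proof -
    have ijk: "i + j + k = d"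
      using that by (simp add: multi_indices_def)
    show ?thesis
    proof (cases "(i, j, k) = t")
      case True
      moreover have "L (real i0 / d) (real j0 / d) (real k0 / d) \<noteq> 0"
        unfolding val[OF sum0] by simp
      ultimately show ?thesis
        by (simp add: g_def t_eq)
    next
      case False
      \<comment> \<open>Two different triples with the same sum must differ downwards in some
        component, and there one factor of \<open>L\<close> vanishes.\<close>
      then have "i < i0 \<or> j < j0 \<or> k < k0"
        using ijk sum0 by (auto simp: t_eq)
      then have "L (real i / d) (real j / d) (real k / d) = 0"
        unfolding val[OF ijk] using zero[of i i0] zero[of j j0] zero[of k k0] by simp
      then show ?thesis
        using False by (simp add: g_def)
    qed
  qed
  ultimately show thesis by (rule that)
qed

section \<open>Bernstein--Bezier polynomials\<close>

text \<open>Twice the signed area, and the Jacobian determinant of the parametrization of the plane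
  by the two edge vectors at the first vertex.\<close>

fun triangle_det :: "triangle \<Rightarrow> real" where
  "triangle_det ((x1, y1), (x2, y2), (x3, y3)) = (x2 - x1) * (y3 - y1) - (x3 - x1) * (y2 - y1)"

lemma nondegenerate_imp_triangle_det:
  assumes "nondegenerate T"
  shows "triangle_det T \<noteq> 0"
proof -
  obtain x1 y1 x2 y2 x3 y3 where T: "T = ((x1, y1), (x2, y2), (x3, y3))"
    by (metis surj_pair)
  \<comment> \<open>The lemma \<open>collinear_3\<close> subtracts the middle point, so the first
    vertex is moved to the middle.\<close>
  have "\<not> collinear {(x2, y2), (x1, y1), (x3, y3)}"
    using assms by (simp add: T insert_commute)
  then have nc: "\<not> collinear {0, (x2 - x1, y2 - y1), (x3 - x1, y3 - y1)}"
    by (subst (asm) collinear_3) simp_all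
  show ?thesis
  proof
    assume "triangle_det T = 0"
    then have D: "(x2 - x1) * (y3 - y1) = (x3 - x1) * (y2 - y1)"
      by (simp add: T)
    have "\<exists>c. (x3 - x1, y3 - y1) = c *\<^sub>R (x2 - x1, y2 - y1)" if "(x2 - x1, y2 - y1) \<noteq> 0"
    proof (cases "x2 - x1 = 0")
      case True
      with that D show ?thesis
        by (intro exI[of _ "(y3 - y1) / (y2 - y1)"]) (auto simp: zero_prod_def)
    next
      case False
      with D show ?thesis
        by (intro exI[of _ "(x3 - x1) / (x2 - x1)"]) (auto simp: field_simps)
    qed
    with nc show False
      by (auto simp: collinear_lemma)
  qed
qed

text \<open>Cramer's rule: eliminating either unknown leaves the other one multiplied by the
  determinant.\<close>

lemma homogeneous_2x2_trivial:
  fixes p r :: real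
  assumes "p * u1 + r * w1 = 0" "p * u2 + r * w2 = 0" "u1 * w2 - w1 * u2 \<noteq> 0"
  shows "p = 0 \<and> r = 0"
proof -
  have "p * (u1 * w2 - w1 * u2) = (p * u1 + r * w1) * w2 - (p * u2 + r * w2) * w1"
    "r * (u1 * w2 - w1 * u2) = (p * u2 + r * w2) * u1 - (p * u1 + r * w1) * u2"
    by (simp_all add: algebra_simps)
  then have "p * (u1 * w2 - w1 * u2) = 0" "r * (u1 * w2 - w1 * u2) = 0"
    unfolding assms(1,2) by simp_all
  then show ?thesis
    using assms(3) by simp
qed

text \<open>Uniqueness justifies the \<open>THE\<close>: once the first coordinate is eliminated,
  the difference of two solutions solves a homogeneous system whose determinant is
  \<open>triangle_det\<close>.\<close>

lemma barycentric_eqI: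
  assumes D: "triangle_det ((x1, y1), (x2, y2), (x3, y3)) \<noteq> 0"
    and b: "x = b1 * x1 + b2 * x2 + b3 * x3" "y = b1 * y1 + b2 * y2 + b3 * y3" "1 = b1 + b2 + b3"
  shows "barycentric ((x1, y1), (x2, y2), (x3, y3)) (x, y) = (b1, b2, b3)"
  unfolding barycentric.simps
proof (rule the_equality)
  fix c :: "real \<times> real \<times> real"
  assume "case c of (c1, c2, c3) \<Rightarrow> x = c1 * x1 + c2 * x2 + c3 * x3 \<and>
    y = c1 * y1 + c2 * y2 + c3 * y3 \<and> 1 = c1 + c2 + c3"
  then obtain c1 c2 c3 where c: "c = (c1, c2, c3)"
    "x = c1 * x1 + c2 * x2 + c3 * x3" "y = c1 * y1 + c2 * y2 + c3 * y3" "1 = c1 + c2 + c3"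
    by (cases c) auto
  have 1: "b1 = 1 - b2 - b3" "c1 = 1 - c2 - c3"
    using b(3) c(4) by auto
  have "(c2 - b2) * (x2 - x1) + (c3 - b3) * (x3 - x1) = 0"
       "(c2 - b2) * (y2 - y1) + (c3 - b3) * (y3 - y1) = 0"
    using b(1,2) c(2,3) unfolding 1 by (simp_all add: algebra_simps)
  then have "c2 - b2 = 0 \<and> c3 - b3 = 0"
    using D by (intro homogeneous_2x2_trivial) auto
  then show "c = (b1, b2, b3)"
    using 1 c(1) by simp
qed (use b in simp)

lemma barycentric_affine:
  assumes D: "triangle_det T \<noteq> 0"
  obtains a1 b1 c1 a2 b2 c2 a3 b3 c3 where
    "\<And>x y. barycentric T (x, y) =
      (a1 * x + b1 * y + c1, a2 * x + b2 * y + c2, a3 * x + b3 * y + c3)"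
proof -
  obtain x1 y1 x2 y2 x3 y3 where T: "T = ((x1, y1), (x2, y2), (x3, y3))"
    by (metis surj_pair)
  define E where "E = triangle_det T"
  \<comment> \<open>These are the coefficients given by Cramer's rule for the second and third
    coordinate; the first coordinate is 1 minus the other two.\<close>
  define a2 where "a2 = (y3 - y1) / E"
  define b2 where "b2 = (x1 - x3) / E"
  define c2 where "c2 = ((x3 - x1) * y1 - (y3 - y1) * x1) / E"
  define a3 where "a3 = (y1 - y2) / E"
  define b3 where "b3 = (x2 - x1) / E"
  define c3 where "c3 = ((y2 - y1) * x1 - (x2 - x1) * y1) / E"
  have E: "E \<noteq> 0" "E = (x2 - x1) * (y3 - y1) - (x3 - x1) * (y2 - y1)"
    using D by (simp_all add: E_def T)
  have "barycentric T (x, y) = ((- a2 - a3) * x + (- b2 - b3) * y + (1 - c2 - c3),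
      a2 * x + b2 * y + c2, a3 * x + b3 * y + c3)" for x y
  proof -
    define s t where "s = a2 * x + b2 * y + c2" and "t = a3 * x + b3 * y + c3"
    have scaled: "E * s = (x - x1) * (y3 - y1) - (x3 - x1) * (y - y1)"
        "E * t = (x2 - x1) * (y - y1) - (x - x1) * (y2 - y1)"
      unfolding s_def t_def a2_def b2_def c2_def a3_def b3_def c3_def
      using E(1) by (simp_all add: field_simps)
    have "E * (x - ((1 - s - t) * x1 + s * x2 + t * x3)) =
        E * (x - x1) - (E * s) * (x2 - x1) - (E * t) * (x3 - x1)"
      by (simp add: algebra_simps)
    also have "\<dots> = 0"
      unfolding scaled unfolding E(2) by (simp add: algebra_simps)
    finally have x: "x = (1 - s - t) * x1 + s * x2 + t * x3"
      using E(1) by simp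
    have "E * (y - ((1 - s - t) * y1 + s * y2 + t * y3)) =
        E * (y - y1) - (E * s) * (y2 - y1) - (E * t) * (y3 - y1)"
      by (simp add: algebra_simps)
    also have "\<dots> = 0"
      unfolding scaled unfolding E(2) by (simp add: algebra_simps)
    finally have y: "y = (1 - s - t) * y1 + s * y2 + t * y3"
      using E(1) by simp
    have "barycentric T (x, y) = (1 - s - t, s, t)"
      using D x y unfolding T by (intro barycentric_eqI) auto
    then show ?thesis
      by (simp add: s_def t_def algebra_simps)
  qed
  then show thesis by (rule that)
qed

text \<open>The barycentric coordinates are affine in the point. Multiplying their constant terms by
  a third variable makes them linear forms, whose product of powers is a form of degree
  \<open>d\<close>; setting that variable to 1 gives back the polynomial.\<close>

lemma bernstein_bezier_in_poly_space:
  assumes D: "triangle_det T \<noteq> 0" and t: "t \<in> multi_indices d"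
  shows "bernstein_bezier T d t \<in> poly_space d"
proof -
  obtain i j k where ijk: "t = (i, j, k)" "i + j + k = d"
    using t by (cases t) (auto simp: multi_indices_def)
  obtain a1 b1 c1 a2 b2 c2 a3 b3 c3 where bary: "\<And>x y. barycentric T (x, y) =
      (a1 * x + b1 * y + c1, a2 * x + b2 * y + c2, a3 * x + b3 * y + c3)"
    using barycentric_affine[OF D] by blast
  define g where "g x y z = fact d / (fact i * fact j * fact k) *
      ((a1 * x + b1 * y + c1 * z) ^ i * ((a2 * x + b2 * y + c2 * z) ^ j *
      ((a3 * x + b3 * y + c3 * z) ^ k * 1)))" for x y z :: real
  have "g \<in> ternary_forms (i + (j + (k + 0)))"
    unfolding g_def
    by (intro scale_in_ternary_forms linear_power_mult_in_ternary_forms one_in_ternary_forms)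
  then have "(\<lambda>(x, y). g x y 1) \<in> poly_space d"
    using dehomogenize_in_poly_space ijk(2) by (simp add: add.assoc)
  also have "(\<lambda>(x, y). g x y 1) = bernstein_bezier T d t"
    by (auto simp: fun_eq_iff g_def ijk(1) bary simp del: barycentric.simps)
  finally show ?thesis .
qed

section \<open>Basis values at the domain points\<close>

text \<open>The barycentric coordinates of a domain point are its index divided by \<open>d\<close>;
  they sum to 1 since \<open>d \<ge> 1\<close>.\<close>

lemma bernstein_bezier_domain_point:
  assumes D: "triangle_det T \<noteq> 0" and "d \<ge> 1" and "(i, j, k) \<in> multi_indices d"
  shows "bernstein_bezier T d (l, m, n) (domain_point T d (i, j, k)) =
    fact d / (fact l * fact m * fact n) * ((real i / d) ^ l * (real j / d) ^ m * (real k / d) ^ n)"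
proof -
  obtain x1 y1 x2 y2 x3 y3 where T: "T = ((x1, y1), (x2, y2), (x3, y3))"
    by (metis surj_pair)
  have "real i / d + real j / d + real k / d = 1"
    using assms by (auto simp: multi_indices_def add_divide_distrib[symmetric])
  moreover have "domain_point T d (i, j, k) =
      (real i / d * x1 + real j / d * x2 + real k / d * x3, real i / d * y1 + real j / d * y2 + real k / d * y3)"
    by (simp add: T add_divide_distrib)
  ultimately have "barycentric T (domain_point T d (i, j, k)) = (real i / d, real j / d, real k / d)"
    using barycentric_eqI[OF D[unfolded T] refl refl] by (simp only: T)
  then show ?thesis
    by (simp del: domain_point.simps)
qed

text \<open>This yields one column of a right inverse of the matrix of basis values: the
  coefficients of the Lagrange form for \<open>t\<close>, divided by the multinomial factors of the
  basis polynomials.\<close>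

lemma bernstein_bezier_lagrange:
  assumes D: "triangle_det T \<noteq> 0" and "d \<ge> 1" and "t \<in> multi_indices d"
  shows "\<exists>c. \<forall>r \<in> multi_indices d.
    (\<Sum>s \<in> multi_indices d. bernstein_bezier T d s (domain_point T d r) * c s) = (if r = t then 1 else 0)"
proof -
  obtain g where g: "g \<in> ternary_forms d"
    "\<And>i j k. (i, j, k) \<in> multi_indices d \<Longrightarrow>
      g (real i / real d) (real j / real d) (real k / real d) = (if (i, j, k) = t then 1 else 0)"
    using lagrange_ternary_form[OF assms(3,2)] by blast
  obtain c where c: "\<And>x y z.
      g x y z = (\<Sum>(i, j, k) \<in> multi_indices d. c (i, j, k) * (x ^ i * y ^ j * z ^ k))"
    using ternary_formsE[OF g(1)] by blast
  define c' where "c' = (\<lambda>(l, m, n). fact l * fact m * fact n / fact d * c (l, m, n))"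
  have "(\<Sum>s \<in> multi_indices d. bernstein_bezier T d s (domain_point T d (i, j, k)) * c' s) =
      g (real i / real d) (real j / real d) (real k / real d)" if "(i, j, k) \<in> multi_indices d" for i j k
    unfolding c by (intro sum.cong) (auto simp: bernstein_bezier_domain_point[OF D \<open>d \<ge> 1\<close> that] c'_def
        simp del: bernstein_bezier.simps domain_point.simps)
  then show ?thesis
    using g(2) by (intro exI[of _ c']) auto
qed

section \<open>The matrix of basis values, its inverse and the weights\<close>

lemma sum_index_list:
  "(\<Sum>r < (d + 2) choose 2. h (index_list d ! r)) = (\<Sum>t \<in> multi_indices d. h t)"
  using sum.reindex_bij_betw[OF bij_betw_nth[OF distinct_index_list refl refl], of h d]
  by (simp add: length_index_list set_index_list atLeast0LessThan)

lemma index_list_in_multi_indices: "r < (d + 2) choose 2 \<Longrightarrow> index_list d ! r \<in> multi_indices d"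
  by (metis length_index_list nth_mem set_index_list)

lemma index_pos_nth: "r < (d + 2) choose 2 \<Longrightarrow> index_pos d (index_list d ! r) = r"
  unfolding index_pos_def
  by (rule the_equality) (auto simp: length_index_list nth_eq_iff_index_eq[OF distinct_index_list])

lemma bb_matrix_carrier:
  "bb_matrix T d \<in> carrier_mat ((d + 2) choose 2) ((d + 2) choose 2)"
  by (simp add: bb_matrix_def)

lemma bb_matrix_mult_index:
  fixes d :: nat
  defines "N \<equiv> (d + 2) choose 2"
  assumes "M \<in> carrier_mat N N" "r < N" "s < N"
  shows "(bb_matrix T d * M) $$ (r, s) = (\<Sum>l<N.
    bernstein_bezier T d (index_list d ! l) (domain_point T d (index_list d ! r)) * M $$ (l, s))"
  using assms(2-)
  by (auto simp: bb_matrix_def N_def[symmetric] scalar_prod_def atLeast0LessThan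
      simp del: add_2_eq_Suc add_2_eq_Suc' intro!: sum.cong)

text \<open>For square matrices over a field a right inverse is two-sided. So the Lagrange
  coefficients, taken as columns, show that the matrix is a unit, and \<open>mat_inverse\<close>
  returns \<open>None\<close> only for non-units.\<close>

lemma mat_inverse_bb_matrix:
  fixes d :: nat
  defines "N \<equiv> (d + 2) choose 2"
  assumes D: "triangle_det T \<noteq> 0" and "d \<ge> 1"
  obtains M where "mat_inverse (bb_matrix T d) = Some M" "M \<in> carrier_mat N N"
    "bb_matrix T d * M = 1\<^sub>m N"
proof -
  have B: "bb_matrix T d \<in> carrier_mat N N"
    unfolding N_def by (rule bb_matrix_carrier)
  have "\<exists>c. \<forall>t \<in> multi_indices d. \<forall>r \<in> multi_indices d.
    (\<Sum>s \<in> multi_indices d. bernstein_bezier T d s (domain_point T d r) * c t s) = (if r = t then 1 else 0)"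
    using bernstein_bezier_lagrange[OF assms(2,3)] by (intro bchoice) blast
  then obtain c where c: "\<And>t r. t \<in> multi_indices d \<Longrightarrow> r \<in> multi_indices d \<Longrightarrow>
    (\<Sum>s \<in> multi_indices d. bernstein_bezier T d s (domain_point T d r) * c t s) = (if r = t then 1 else 0)"
    by blast
  define C where "C = Matrix.mat N N (\<lambda>(r, s). c (index_list d ! s) (index_list d ! r))"
  have C: "C \<in> carrier_mat N N"
    by (simp add: C_def)
  have BC: "bb_matrix T d * C = 1\<^sub>m N"
  proof (rule eq_matI)
    fix r s assume rs: "r < dim_row (1\<^sub>m N :: real mat)" "s < dim_col (1\<^sub>m N :: real mat)"
    then have "(bb_matrix T d * C) $$ (r, s) = (\<Sum>l < N.
        bernstein_bezier T d (index_list d ! l) (domain_point T d (index_list d ! r))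
        * c (index_list d ! s) (index_list d ! l))"
      using C by (auto simp: N_def bb_matrix_mult_index C_def intro!: sum.cong)
    also have "\<dots> = (\<Sum>l \<in> multi_indices d.
        bernstein_bezier T d l (domain_point T d (index_list d ! r)) * c (index_list d ! s) l)"
      unfolding N_def by (rule sum_index_list)
    also have "\<dots> = (if index_list d ! r = index_list d ! s then 1 else 0)"
      using rs by (intro c) (auto simp: N_def index_list_in_multi_indices)
    also have "\<dots> = 1\<^sub>m N $$ (r, s)"
      using rs by (auto simp: N_def nth_eq_iff_index_eq[OF distinct_index_list] length_index_list)
    finally show "(bb_matrix T d * C) $$ (r, s) = 1\<^sub>m N $$ (r, s)" .
  qed (use B C in auto)
  have CB: "C * bb_matrix T d = 1\<^sub>m N"
    by (rule mat_mult_left_right_inverse[OF B C BC])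
  have "bb_matrix T d \<in> Units (ring_mat TYPE(real) N ())"
    using B C BC CB by (auto simp: Units_def ring_mat_def)
  then have "mat_inverse (bb_matrix T d) \<noteq> None"
    using mat_inverse(1)[OF B, where b = "()"] by blast
  then obtain M where "mat_inverse (bb_matrix T d) = Some M"
    by blast
  then show thesis
    using mat_inverse(2)[OF B] that by blast
qed

text \<open>The witness is the inverse matrix applied to \<open>v\<close>. The first property is
  that the matrix times its inverse is the identity; the second exchanges the two summations,
  turning column sums weighted by \<open>v\<close> into the sum of all coefficients.\<close>

lemma quadrature_weight_interpolant:
  assumes D: "triangle_det T \<noteq> 0" and "d \<ge> 1"
  obtains a where
    "\<And>r. r \<in> multi_indices d \<Longrightarrow>
      (\<Sum>s \<in> multi_indices d. a s * bernstein_bezier T d s (domain_point T d r)) = v r"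
    "(\<Sum>t \<in> multi_indices d. quadrature_weight T d t * v t) =
      area T / real ((d + 2) choose 2) * (\<Sum>s \<in> multi_indices d. a s)"
proof -
  define N where "N = (d + 2) choose 2"
  obtain M where M: "mat_inverse (bb_matrix T d) = Some M" "M \<in> carrier_mat N N"
    "bb_matrix T d * M = 1\<^sub>m N"
    using mat_inverse_bb_matrix[OF assms] unfolding N_def by metis
  define b where "b r = (\<Sum>c<N. M $$ (r, c) * v (index_list d ! c))" for r
  \<comment> \<open>The matrix product lives on positions \<open>r < N\<close>;
    \<open>index_pos\<close> carries it over to triples.\<close>
  define a where "a s = b (index_pos d s)" for s
  have a_nth: "a (index_list d ! r) = b r" if "r < N" for r
    using that by (simp add: a_def N_def index_pos_nth)
  show thesis
  proof
    fix t assume "t \<in> multi_indices d"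
    then obtain r where r: "r < N" "t = index_list d ! r"
      by (metis N_def in_set_conv_nth length_index_list set_index_list)
    let ?B = "\<lambda>s. bernstein_bezier T d s (domain_point T d t)"
    have "(\<Sum>s \<in> multi_indices d. a s * ?B s) = (\<Sum>l<N. b l * ?B (index_list d ! l))"
      unfolding sum_index_list[symmetric] N_def[symmetric] by (intro sum.cong) (auto simp: a_nth)
    also have "\<dots> = (\<Sum>l<N. \<Sum>c<N. ?B (index_list d ! l) * M $$ (l, c) * v (index_list d ! c))"
      by (simp add: b_def sum_distrib_left sum_distrib_right ac_simps)
    also have "\<dots> = (\<Sum>c<N. (\<Sum>l<N. ?B (index_list d ! l) * M $$ (l, c)) * v (index_list d ! c))"
      by (subst sum.swap) (simp add: sum_distrib_right)
    also have "\<dots> = (\<Sum>c<N. (bb_matrix T d * M) $$ (r, c) * v (index_list d ! c))"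
      using M(2) r by (intro sum.cong refl) (simp add: N_def bb_matrix_mult_index)
    also have "\<dots> = (\<Sum>c<N. if c = r then v (index_list d ! c) else 0)"
      using r by (intro sum.cong) (auto simp: M(3))
    also have "\<dots> = v t"
      using r by simp
    finally show "(\<Sum>s \<in> multi_indices d. a s * ?B s) = v t" .
  next
    have "(\<Sum>t \<in> multi_indices d. quadrature_weight T d t * v t) =
        (\<Sum>c<N. area T / real N * (\<Sum>r<N. M $$ (r, c)) * v (index_list d ! c))"
      unfolding sum_index_list[symmetric] N_def[symmetric]
      using M(1,2)
      by (intro sum.cong refl) (auto simp: quadrature_weight_def column_sum_def N_def index_pos_nth)
    also have "\<dots> = area T / real N * (\<Sum>c<N. \<Sum>r<N. M $$ (r, c) * v (index_list d ! c))"
      by (simp add: sum_distrib_left sum_distrib_right mult.assoc)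
    also have "\<dots> = area T / real N * (\<Sum>r<N. b r)"
      by (subst sum.swap) (simp add: b_def)
    also have "(\<Sum>r<N. b r) = (\<Sum>s \<in> multi_indices d. a s)"
      unfolding sum_index_list[symmetric] N_def[symmetric] by (intro sum.cong) (auto simp: a_nth)
    finally show "(\<Sum>t \<in> multi_indices d. quadrature_weight T d t * v t) =
      area T / real ((d + 2) choose 2) * (\<Sum>s \<in> multi_indices d. a s)"
      by (simp add: N_def)
  qed
qed

section \<open>Area and integrals of the basis polynomials\<close>

lemma compact_region: "compact (region T)"
proof (cases T)
  case (fields v1 v2 v3)
  then show ?thesis by (simp add: finite_imp_compact_convex_hull)
qed

text \<open>A point of the convex hull has some admissible parameters \<open>u\<close> and
  \<open>v\<close>; linear independence of the edge vectors identifies them with \<open>s\<close>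
  and \<open>t\<close>.\<close>

lemma param_in_region:
  assumes D: "triangle_det ((x1, y1), (x2, y2), (x3, y3)) \<noteq> 0"
  shows "(x1 + s * (x2 - x1) + t * (x3 - x1), y1 + s * (y2 - y1) + t * (y3 - y1))
      \<in> region ((x1, y1), (x2, y2), (x3, y3)) \<longleftrightarrow> 0 \<le> s \<and> 0 \<le> t \<and> s + t \<le> 1"
proof
  assume "(x1 + s * (x2 - x1) + t * (x3 - x1), y1 + s * (y2 - y1) + t * (y3 - y1))
      \<in> region ((x1, y1), (x2, y2), (x3, y3))"
  then obtain u v where uv: "0 \<le> u" "0 \<le> v" "u + v \<le> 1"
    "s * (x2 - x1) + t * (x3 - x1) = u * (x2 - x1) + v * (x3 - x1)"
    "s * (y2 - y1) + t * (y3 - y1) = u * (y2 - y1) + v * (y3 - y1)"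
    by (auto simp: convex_hull_3_alt)
  then have "s - u = 0 \<and> t - v = 0"
    using D by (intro homogeneous_2x2_trivial[of _ "x2 - x1" _ "x3 - x1" "y2 - y1" "y3 - y1"])
      (auto simp: algebra_simps)
  then show "0 \<le> s \<and> 0 \<le> t \<and> s + t \<le> 1"
    using uv by simp
qed (auto simp: convex_hull_3_alt)

text \<open>On the standard simplex the barycentric coordinates become
  \<open>(1 - s - r, s, r)\<close>, and the Dirichlet integral cancels the factorials of
  \<open>i\<close>, \<open>j\<close> and \<open>k\<close>. What remains depends on \<open>d\<close>
  only, so all basis polynomials of degree \<open>d\<close> have the same integral.\<close>

lemma nn_integral_bernstein_bezier:
  assumes D: "triangle_det T \<noteq> 0" and t: "t \<in> multi_indices d"
  shows "(\<integral>\<^sup>+ z. ennreal (bernstein_bezier T d t z) * indicator (region T) z \<partial>lborel) =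
    ennreal (\<bar>triangle_det T\<bar> / 2 / real ((d + 2) choose 2))"
proof -
  obtain x1 y1 x2 y2 x3 y3 where T: "T = ((x1, y1), (x2, y2), (x3, y3))"
    by (metis surj_pair)
  obtain i j k where ijk: "t = (i, j, k)" "i + j + k = d"
    using t by (cases t) (auto simp: multi_indices_def)
  have [measurable]: "bernstein_bezier T d t \<in> borel_measurable borel"
    using continuous_on_poly_space[OF bernstein_bezier_in_poly_space[OF assms]]
    by (rule borel_measurable_continuous_onI)
  have [measurable]: "region T \<in> sets borel"
    using compact_region by (simp add: borel_compact)
  have "closed {z :: real \<times> real. 0 \<le> fst z \<and> 0 \<le> snd z \<and> fst z + snd z \<le> 1}"
    by (intro closed_Collect_conj closed_Collect_le continuous_intros)
  then have [measurable]: "{(s :: real, r). 0 \<le> s \<and> 0 \<le> r \<and> s + r \<le> 1} \<in> sets (lborel \<Otimes>\<^sub>M lborel)"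
    unfolding lborel_prod by (simp add: borel_closed case_prod_unfold)
  have in_region: "(x1 + s * (x2 - x1) + r * (x3 - x1), y1 + s * (y2 - y1) + r * (y3 - y1)) \<in> region T
      \<longleftrightarrow> 0 \<le> s \<and> 0 \<le> r \<and> s + r \<le> 1" for s r
    using D unfolding T by (rule param_in_region)
  have integrand: "(\<lambda>z. ennreal (bernstein_bezier T d t z) * indicator (region T) z) \<in> borel_measurable borel"
    by measurable
  have det: "triangle_det T = (x2 - x1) * (y3 - y1) - (x3 - x1) * (y2 - y1)"
    by (simp add: T)
  define C :: real where "C = fact d / (fact i * fact j * fact k)"
  have at_param: "bernstein_bezier T d t (x1 + s * (x2 - x1) + r * (x3 - x1), y1 + s * (y2 - y1) + r * (y3 - y1))
    = C * ((1 - s - r) ^ i * s ^ j * r ^ k)" for s r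
  proof -
    have "barycentric T (x1 + s * (x2 - x1) + r * (x3 - x1), y1 + s * (y2 - y1) + r * (y3 - y1))
      = (1 - s - r, s, r)"
      using D unfolding T by (intro barycentric_eqI) (auto simp: algebra_simps)
    then show ?thesis by (simp add: ijk C_def)
  qed
  have "(\<integral>\<^sup>+ z. ennreal (bernstein_bezier T d t z) * indicator (region T) z \<partial>lborel) =
    ennreal \<bar>triangle_det T\<bar> * (\<integral>\<^sup>+ r. \<integral>\<^sup>+ s. (\<lambda>z. ennreal (bernstein_bezier T d t z) * indicator (region T) z)
      (x1 + s * (x2 - x1) + r * (x3 - x1), y1 + s * (y2 - y1) + r * (y3 - y1)) \<partial>lborel \<partial>lborel)"
    unfolding det by (rule nn_integral_affine_plane[OF integrand]) (use D det in simp)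
  also have "(\<integral>\<^sup>+ r. \<integral>\<^sup>+ s. (\<lambda>z. ennreal (bernstein_bezier T d t z) * indicator (region T) z)
      (x1 + s * (x2 - x1) + r * (x3 - x1), y1 + s * (y2 - y1) + r * (y3 - y1)) \<partial>lborel \<partial>lborel) =
    (\<integral>\<^sup>+ r. \<integral>\<^sup>+ s. ennreal C * (ennreal ((1 - s - r) ^ i * s ^ j * r ^ k) *
      indicator {(s, r). 0 \<le> s \<and> 0 \<le> r \<and> s + r \<le> 1} (s, r)) \<partial>lborel \<partial>lborel)"
    by (intro nn_integral_cong)
       (simp add: at_param in_region indicator_def ennreal_mult'[symmetric] C_def)
  also have "\<dots> = ennreal C * (\<integral>\<^sup>+ r. \<integral>\<^sup>+ s. ennreal ((1 - s - r) ^ i * s ^ j * r ^ k) *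
      indicator {(s, r). 0 \<le> s \<and> 0 \<le> r \<and> s + r \<le> 1} (s, r) \<partial>lborel \<partial>lborel)"
    by (subst nn_integral_cmult, measurable, subst nn_integral_cmult, measurable)
  also have "\<dots> = ennreal (fact d / fact (d + 2))"
    unfolding nn_integral_standard_simplex ijk(2) by (simp add: C_def ennreal_mult'[symmetric])
  also have "ennreal \<bar>triangle_det T\<bar> * \<dots> = ennreal (\<bar>triangle_det T\<bar> / 2 / real ((d + 2) choose 2))"
  proof -
    \<comment> \<open>Thus \<open>fact d / fact (d + 2)\<close> is half the reciprocal of the number
      of indices.\<close>
    have "fact (d + 2) = real (fact d) * (2 * real ((d + 2) choose 2))"
    proof -
      have "2 * ((d + 2) choose 2) = (d + 2) * (d + 1)"
        by (induction d) (simp_all add: numeral_2_eq_2)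
      then have "real (2 * ((d + 2) choose 2)) = real ((d + 2) * (d + 1))"
        by (simp only:)
      then have "2 * real ((d + 2) choose 2) = (real d + 2) * (real d + 1)"
        by (simp only: of_nat_mult of_nat_add of_nat_numeral of_nat_1)
      then show ?thesis
        by (simp only: fact_Suc add_2_eq_Suc') (simp add: algebra_simps)
    qed
    then show ?thesis
      by (simp add: ennreal_mult'[symmetric] del: fact_Suc)
  qed
  finally show ?thesis .
qed

text \<open>The case of degree 0 of the preceding integral: the only basis polynomial is the
  constant 1, and \<open>2 choose 2\<close> is 1.\<close>

lemma area_eq:
  assumes "triangle_det T \<noteq> 0"
  shows "area T = \<bar>triangle_det T\<bar> / 2"
proof -
  have "bernstein_bezier T 0 (0, 0, 0) z = 1" for z
    by (simp split: prod.split)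
  then have "emeasure lborel (region T) = ennreal (\<bar>triangle_det T\<bar> / 2)"
    using nn_integral_bernstein_bezier[OF assms, of "(0, 0, 0)" 0] compact_region[of T]
    by (simp add: multi_indices_def borel_compact numeral_2_eq_2 del: bernstein_bezier.simps)
  then show ?thesis
    using compact_region[of T] by (simp add: area_def measure_def borel_compact)
qed

text \<open>Points of the triangle have nonnegative barycentric coordinates. Nonnegativity allows
  the Bochner integral to be read off from the \<open>ennreal\<close> one.\<close>

lemma bernstein_bezier_nonneg:
  assumes D: "triangle_det T \<noteq> 0" and z: "z \<in> region T"
  shows "0 \<le> bernstein_bezier T d t z"
proof -
  obtain x1 y1 x2 y2 x3 y3 where T: "T = ((x1, y1), (x2, y2), (x3, y3))"
    by (metis surj_pair)
  obtain i j k where t: "t = (i, j, k)"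
    by (cases t)
  obtain u v w where uvw: "0 \<le> u" "0 \<le> v" "0 \<le> w" "u + v + w = 1"
    and z_eq: "z = (u * x1 + v * x2 + w * x3, u * y1 + v * y2 + w * y3)"
    using z by (auto simp: T convex_hull_3)
  have "barycentric T z = (u, v, w)"
    using D uvw unfolding T z_eq by (intro barycentric_eqI) auto
  with uvw show ?thesis
    by (simp add: t)
qed

lemma integral_bernstein_bezier:
  assumes D: "triangle_det T \<noteq> 0" and t: "t \<in> multi_indices d"
  shows "(\<integral>z. bernstein_bezier T d t z \<partial>lebesgue_on (region T)) = area T / real ((d + 2) choose 2)"
proof -
  have B: "bernstein_bezier T d t \<in> borel_measurable borel"
    using continuous_on_poly_space[OF bernstein_bezier_in_poly_space[OF assms]]
    by (rule borel_measurable_continuous_onI)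
  have R: "region T \<in> sets borel"
    using compact_region by (simp add: borel_compact)
  have "(\<integral>\<^sup>+ z. ennreal (bernstein_bezier T d t z) \<partial>lebesgue_on (region T)) =
      (\<integral>\<^sup>+ z. ennreal (bernstein_bezier T d t z) * indicator (region T) z \<partial>lborel)"
    using R by (subst nn_integral_restrict_space) (auto simp: nn_integral_completion)
  also note nn_integral_bernstein_bezier[OF assms]
  finally have nn: "(\<integral>\<^sup>+ z. ennreal (bernstein_bezier T d t z) \<partial>lebesgue_on (region T)) =
      ennreal (\<bar>triangle_det T\<bar> / 2 / real ((d + 2) choose 2))" .
  have "bernstein_bezier T d t \<in> borel_measurable (completion lborel)"
    using B by (intro measurable_completion) simp
  then have "bernstein_bezier T d t \<in> borel_measurable (lebesgue_on (region T))"
    by (rule measurable_restrict_space1)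
  moreover have "AE z in lebesgue_on (region T). 0 \<le> bernstein_bezier T d t z"
    using bernstein_bezier_nonneg[OF D] by (intro AE_I2) (simp only: space_lebesgue_on)
  ultimately have "(\<integral>z. bernstein_bezier T d t z \<partial>lebesgue_on (region T)) =
      enn2real (ennreal (\<bar>triangle_det T\<bar> / 2 / real ((d + 2) choose 2)))"
    by (simp only: integral_eq_nn_integral nn)
  also have "\<dots> = area T / real ((d + 2) choose 2)"
    unfolding area_eq[OF D] by (rule enn2real_ennreal) simp
  finally show ?thesis .
qed

section \<open>The error estimate\<close>

theorem theorem3p2:
  fixes T :: triangle and d :: nat and p q :: ennreal
    and f :: "real \<times> real \<Rightarrow> real" and K1 :: real
  assumes "nondegenerate T"
    and "d \<ge> 1"
    and "1 \<le> p"
    and "1 / p + 1 / q = 1"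
    and "f \<in> sobolev_space (d + 1) p T"
    and "interpolation_constant d p T K1"
  shows "\<bar>(LINT z:region T|lebesgue. f z) -
          (\<Sum>t \<in> multi_indices d.
             quadrature_weight T d t * continuous_rep T f (domain_point T d t))\<bar>
         \<le> K1 * \<bar>area T\<bar> powr enn2real (1 / q) * longest_edge T ^ (d + 1) *
           sobolev_seminorm (d + 1) p T f"
proof -
  define R where "R = region T"
  define v where "v t = continuous_rep T f (domain_point T d t)" for t
  have D: "triangle_det T \<noteq> 0"
    using assms(1) by (rule nondegenerate_imp_triangle_det)
  have area_pos: "area T > 0"
    using D by (simp add: area_eq)
  have "compact R"
    by (simp add: R_def compact_region)
  then have R: "R \<in> lmeasurable" "R \<in> sets lebesgue"
    by (simp_all add: lmeasurable_compact fmeasurableD)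
  obtain a where a: "\<And>r. r \<in> multi_indices d \<Longrightarrow>
      (\<Sum>s \<in> multi_indices d. a s * bernstein_bezier T d s (domain_point T d r)) = v r"
    "(\<Sum>t \<in> multi_indices d. quadrature_weight T d t * v t) =
      area T / real ((d + 2) choose 2) * (\<Sum>s \<in> multi_indices d. a s)"
    using quadrature_weight_interpolant[OF D assms(2)] by blast
  \<comment> \<open>This is the interpolant of the continuous representative in Bernstein--Bezier
    form, its coefficients being the inverse matrix applied to the nodal values.\<close>
  define P where "P z = (\<Sum>s \<in> multi_indices d. a s * bernstein_bezier T d s z)" for z
  have P_poly: "P \<in> poly_space d"
    unfolding P_def by (intro poly_space_sum bernstein_bezier_in_poly_space D)
  have "interpolates T d f P"
    using P_poly a(1) by (auto simp: interpolates_def P_def v_def)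
  moreover have "if p = \<infinity> then p = \<infinity>
      else 1 \<le> p \<and> p < \<infinity> \<and> shape_parameter T = shape_parameter T"
    using assms(3) by (simp add: less_top)
  \<comment> \<open>The bound, uniform over triangles and exponents with the same data, is used at
    \<open>T\<close> and \<open>p\<close> themselves.\<close>
  ultimately have interp: "Lp_norm p R (\<lambda>z. f z - P z)
      \<le> K1 * longest_edge T ^ (d + 1) * sobolev_seminorm (d + 1) p T f"
    using assms(1,5,6) unfolding interpolation_constant_def R_def by blast
  have int_cont: "integrable (lebesgue_on R) g" if "g \<in> poly_space d" for g
  proof -
    have "integrable lborel (\<lambda>z. indicator R z *\<^sub>R g z)"
      using \<open>compact R\<close> continuous_on_poly_space[OF that] by (rule borel_integrable_compact)
    then have "integrable lebesgue (\<lambda>z. indicator R z *\<^sub>R g z)"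
      by (subst integrable_completion) auto
    then show ?thesis
      using R(2) by (subst integrable_restrict_space) auto
  qed
  \<comment> \<open>Exactness of the rule on the interpolant: all basis integrals agree, so only the
    sum of the coefficients enters.\<close>
  have int_P: "(\<integral>z. P z \<partial>lebesgue_on R) = (\<Sum>t \<in> multi_indices d. quadrature_weight T d t * v t)"
  proof -
    have "(\<integral>z. P z \<partial>lebesgue_on R) =
        (\<Sum>s \<in> multi_indices d. a s * (\<integral>z. bernstein_bezier T d s z \<partial>lebesgue_on R))"
      unfolding P_def
      by (subst Bochner_Integration.integral_sum)
         (auto intro!: integrable_mult_right int_cont bernstein_bezier_in_poly_space D)
    also have "\<dots> = (\<Sum>s \<in> multi_indices d. a s * (area T / real ((d + 2) choose 2)))"
      unfolding R_def by (intro sum.cong refl) (simp only: integral_bernstein_bezier[OF D])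
    finally show ?thesis
      unfolding a(2) by (simp only: sum_distrib_right[symmetric] mult.commute[of "sum a _"])
  qed
  have f_Lp: "f \<in> Lp_space p R"
    using assms(5) by (simp add: sobolev_space_def R_def)
  have "bounded (P ` R)"
    using continuous_on_poly_space[OF P_poly] \<open>compact R\<close>
    by (intro compact_imp_bounded compact_continuous_image)
  then obtain M where M: "\<And>z. z \<in> R \<Longrightarrow> \<bar>P z\<bar> \<le> M"
    by (auto simp: bounded_iff)
  have diff_Lp: "(\<lambda>z. f z - P z) \<in> Lp_space p R"
    using int_cont[OF P_poly] by (intro Lp_space_diff_bounded[OF R(1) assms(3) f_Lp _ M]) auto
  have "(LINT z:region T|lebesgue. f z) = (\<integral>z. f z \<partial>lebesgue_on R)"
    using R(2) by (simp add: set_lebesgue_integral_def integral_restrict_space R_def)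
  \<comment> \<open>With the quadrature sum replaced by the integral of \<open>P\<close>, the error
    becomes a single integral of \<open>f - P\<close>.\<close>
  then have "\<bar>(LINT z:region T|lebesgue. f z) - (\<Sum>t \<in> multi_indices d. quadrature_weight T d t * v t)\<bar>
      = \<bar>\<integral>z. f z - P z \<partial>lebesgue_on R\<bar>"
    using integrable_Lp_space[OF R(1) assms(3) f_Lp] int_cont[OF P_poly] by (simp add: int_P)
  also have "\<dots> \<le> area T powr enn2real (1 / q) * Lp_norm p R (\<lambda>z. f z - P z)"
    using abs_integral_le_Lp_norm[OF R(1) _ assms(3,4) diff_Lp] area_pos
    by (simp add: area_def R_def)
  also have "\<dots> \<le> area T powr enn2real (1 / q) *
      (K1 * longest_edge T ^ (d + 1) * sobolev_seminorm (d + 1) p T f)"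
    by (rule mult_left_mono[OF interp]) simp
  finally show ?thesis
    using area_pos by (simp add: v_def ac_simps)
qed

end
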